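(* Let $d\ge 1$ be an integer, $0<h\le 1$, $\sigma>0$, $1\le p\le +\infty$, $\lambda\in\{1,-1\}$, and let $V=\{V_n\}_{n\in h\mathbb{Z}^d}$ be a bounded real-valued sequence. Then, for initial data $(f,g)\in l^p_h\times l^p_h$, the Cauchy problem for the discrete nonlinear Klein-Gordon equation $$ \partial_t^2 u_n(t)-\Delta_h u_n(t)+V_n u_n(t)+\lambda |u_n(t)|^{2\sigma}u_n(t)=0,\qquad u_n(0)=f_n,\quad \partial_t u_n(0)=g_n,\qquad n\in h\mathbb{Z}^d, $$ for real-valued $u=\{u_n\}_{n\in h\mathbb{Z}^d}$, is locally well-posed in $l^p_h\times l^p_h$.
   Context: For a sequence $u=\{u_n\}_{n\in h\mathbb{Z}^d}$, $\|u\|_{l^p_h}=\big(\sum_{n\in h\mathbb{Z}^d}|u_n|^p\big)^{1/p}$ for $1\le p<\infty$ and $\|u\|_{l^\infty_h}=\sup_n|u_n|$; $l^p_h$ is the Banach space of sequences with finite norm. The discrete Laplacian is $\Delta_h u_n=\sum_{j=1}^d h^{-2}(u_{n+he_j}+u_{n-he_j}-2u_n)$, with $(e_j)$ the canonical basis of $\mathbb{R}^d$. Data are $(f,g)=\{(f_n,g_n)\}_{n\in h\mathbb{Z}^d}$, real-valued. Local well-posedness in $X_0=l^p_h\times l^p_h$ refers to the pair $(u,\partial_t u)$ and means: (a) unconditional uniqueness: for each initial datum in $X_0$ and each time interval $I\ni 0$, there is at most one solution with $(u,\partial_t u)\in C(I;X_0)$; (b) for every initial datum in $X_0$ there exists a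 strong solution (with $(u,\partial_t u)\in C(I;X_0)$, satisfying the equation and the initial conditions) on a maximal time interval $I=(-T_{\min},T_{\max})$ with $T_{\min},T_{\max}\in(0,+\infty]$; (c) the solution depends continuously on the initial value (in the standard sense: if the data converge in $X_0$, then on each compact subinterval $J$ of the maximal interval of the limiting solution the approximating solutions eventually exist and converge in $C(J;X_0)$). *)

theory Defs
  imports "HOL-Analysis.Analysis"
begin

(* A sequence indexed by h Z^d is represented by a function on real ^ 'd of which only the
   values on the lattice matter; the dimension d >= 1 is CARD('d). *)

definition hlattice :: "real \<Rightarrow> (real ^ 'd) set" where
  "hlattice h = {n. \<forall>i. \<exists>k::int. n $ i = h * of_int k}"

definition lp_space :: "ereal \<Rightarrow> real \<Rightarrow> (real ^ 'd \<Rightarrow> real) set" where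
  "lp_space p h =
     (if p = \<infinity> then {u. bdd_above ((\<lambda>n. \<bar>u n\<bar>) ` hlattice h)}
      else {u. (\<lambda>n. \<bar>u n\<bar> powr real_of_ereal p) summable_on hlattice h})"

(* Meaningful only on lp_space p h: the real-valued infinite sum and supremum have
   unspecified or default values otherwise. *)
definition lp_norm :: "ereal \<Rightarrow> real \<Rightarrow> (real ^ 'd \<Rightarrow> real) \<Rightarrow> real" where
  "lp_norm p h u =
     (if p = \<infinity> then (SUP n\<in>hlattice h. \<bar>u n\<bar>)
      else (\<Sum>\<^sub>\<infinity>n\<in>hlattice h. \<bar>u n\<bar> powr real_of_ereal p) powr (1 / real_of_ereal p))"

definition discrete_laplacian :: "real \<Rightarrow> (real ^ 'd \<Rightarrow> real) \<Rightarrow> real ^ 'd \<Rightarrow> real" where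
  "discrete_laplacian h u n =
     (\<Sum>j\<in>UNIV. (u (n + h *\<^sub>R axis j 1) + u (n - h *\<^sub>R axis j 1) - 2 * u n) / h\<^sup>2)"

definition X0_space :: "ereal \<Rightarrow> real \<Rightarrow> ((real ^ 'd \<Rightarrow> real) \<times> (real ^ 'd \<Rightarrow> real)) set" where
  "X0_space p h = lp_space p h \<times> lp_space p h"

definition X0_dist ::
  "ereal \<Rightarrow> real \<Rightarrow> (real ^ 'd \<Rightarrow> real) \<times> (real ^ 'd \<Rightarrow> real)
     \<Rightarrow> (real ^ 'd \<Rightarrow> real) \<times> (real ^ 'd \<Rightarrow> real) \<Rightarrow> real" where
  "X0_dist p h w z =
     lp_norm p h (\<lambda>n. fst w n - fst z n) + lp_norm p h (\<lambda>n. snd w n - snd z n)"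

definition X0_continuous_on ::
  "ereal \<Rightarrow> real \<Rightarrow> real set
     \<Rightarrow> (real \<Rightarrow> (real ^ 'd \<Rightarrow> real) \<times> (real ^ 'd \<Rightarrow> real)) \<Rightarrow> bool" where
  "X0_continuous_on p h I w \<longleftrightarrow>
     (\<forall>t\<in>I. w t \<in> X0_space p h) \<and>
     (\<forall>t\<in>I. ((\<lambda>s. X0_dist p h (w s) (w t)) \<longlongrightarrow> 0) (at t within I))"

(* v is the time derivative of u.  Time derivatives are taken for each lattice site n, as in
   the displayed equation, and are one-sided at endpoints belonging to I. *)
definition dnlkg_solution ::
  "ereal \<Rightarrow> real \<Rightarrow> real \<Rightarrow> real \<Rightarrow> (real ^ 'd \<Rightarrow> real) \<Rightarrow> real set
     \<Rightarrow> (real ^ 'd \<Rightarrow> real) \<Rightarrow> (real ^ 'd \<Rightarrow> real)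
     \<Rightarrow> (real \<Rightarrow> real ^ 'd \<Rightarrow> real) \<Rightarrow> (real \<Rightarrow> real ^ 'd \<Rightarrow> real) \<Rightarrow> bool" where
  "dnlkg_solution p h \<sigma> lam V I f g u v \<longleftrightarrow>
     X0_continuous_on p h I (\<lambda>t. (u t, v t)) \<and>
     (\<forall>n\<in>hlattice h. u 0 n = f n \<and> v 0 n = g n) \<and>
     (\<forall>t\<in>I. \<forall>n\<in>hlattice h.
        ((\<lambda>s. u s n) has_real_derivative v t n) (at t within I) \<and>
        (\<exists>a. ((\<lambda>s. v s n) has_real_derivative a) (at t within I) \<and>
             a - discrete_laplacian h (u t) n + V n * u t n
               + lam * \<bar>u t n\<bar> powr (2 * \<sigma>) * u t n = 0))"

definition time_interval :: "ereal \<Rightarrow> ereal \<Rightarrow> real set" where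
  "time_interval Tmin Tmax = {t. - Tmin < ereal t \<and> ereal t < Tmax}"

definition dnlkg_maximal_solution ::
  "ereal \<Rightarrow> real \<Rightarrow> real \<Rightarrow> real \<Rightarrow> (real ^ 'd \<Rightarrow> real) \<Rightarrow> ereal \<Rightarrow> ereal
     \<Rightarrow> (real ^ 'd \<Rightarrow> real) \<Rightarrow> (real ^ 'd \<Rightarrow> real)
     \<Rightarrow> (real \<Rightarrow> real ^ 'd \<Rightarrow> real) \<Rightarrow> (real \<Rightarrow> real ^ 'd \<Rightarrow> real) \<Rightarrow> bool" where
  "dnlkg_maximal_solution p h \<sigma> lam V Tmin Tmax f g u v \<longleftrightarrow>
     0 < Tmin \<and> 0 < Tmax \<and>
     dnlkg_solution p h \<sigma> lam V (time_interval Tmin Tmax) f g u v \<and>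
     (\<forall>J u' v'. is_interval J \<and> 0 \<in> J \<and> dnlkg_solution p h \<sigma> lam V J f g u' v'
        \<longrightarrow> J \<subseteq> time_interval Tmin Tmax)"

definition unconditional_uniqueness ::
  "ereal \<Rightarrow> real \<Rightarrow> real \<Rightarrow> real \<Rightarrow> (real ^ 'd \<Rightarrow> real) \<Rightarrow> bool" where
  "unconditional_uniqueness p h \<sigma> lam V \<longleftrightarrow>
     (\<forall>f g I u v u' v'.
        (f, g) \<in> X0_space p h \<and> is_interval I \<and> 0 \<in> I \<and>
        dnlkg_solution p h \<sigma> lam V I f g u v \<and> dnlkg_solution p h \<sigma> lam V I f g u' v'
        \<longrightarrow> (\<forall>t\<in>I. \<forall>n\<in>hlattice h. u t n = u' t n \<and> v t n = v' t n))"

definition maximal_existence ::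
  "ereal \<Rightarrow> real \<Rightarrow> real \<Rightarrow> real \<Rightarrow> (real ^ 'd \<Rightarrow> real) \<Rightarrow> bool" where
  "maximal_existence p h \<sigma> lam V \<longleftrightarrow>
     (\<forall>f g. (f, g) \<in> X0_space p h
        \<longrightarrow> (\<exists>Tmin Tmax u v. dnlkg_maximal_solution p h \<sigma> lam V Tmin Tmax f g u v))"

definition continuous_dependence ::
  "ereal \<Rightarrow> real \<Rightarrow> real \<Rightarrow> real \<Rightarrow> (real ^ 'd \<Rightarrow> real) \<Rightarrow> bool" where
  "continuous_dependence p h \<sigma> lam V \<longleftrightarrow>
     (\<forall>f g Tmin Tmax u v fk gk Tmink Tmaxk uk vk.
        (f, g) \<in> X0_space p h \<and>
        (\<forall>k::nat. (fk k, gk k) \<in> X0_space p h) \<and>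
        (\<lambda>k. X0_dist p h (fk k, gk k) (f, g)) \<longlonglongrightarrow> 0 \<and>
        dnlkg_maximal_solution p h \<sigma> lam V Tmin Tmax f g u v \<and>
        (\<forall>k. dnlkg_maximal_solution p h \<sigma> lam V (Tmink k) (Tmaxk k) (fk k) (gk k) (uk k) (vk k))
        \<longrightarrow> (\<forall>a b. {a..b} \<subseteq> time_interval Tmin Tmax \<longrightarrow>
               (\<forall>\<^sub>F k in sequentially. {a..b} \<subseteq> time_interval (Tmink k) (Tmaxk k)) \<and>
               (\<forall>\<epsilon>>0. \<forall>\<^sub>F k in sequentially.
                  \<forall>t\<in>{a..b}. X0_dist p h (uk k t, vk k t) (u t, v t) < \<epsilon>)))"

definition dnlkg_locally_well_posed ::
  "ereal \<Rightarrow> real \<Rightarrow> real \<Rightarrow> real \<Rightarrow> (real ^ 'd \<Rightarrow> real) \<Rightarrow> bool" where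
  "dnlkg_locally_well_posed p h \<sigma> lam V \<longleftrightarrow>
     unconditional_uniqueness p h \<sigma> lam V \<and>
     maximal_existence p h \<sigma> lam V \<and>
     continuous_dependence p h \<sigma> lam V"

end

theory Submission
  imports Defs
begin

text \<open>
  As a first-order system in \<open>(u, \<partial>\<^sub>t u)\<close> the equation is an ordinary differential equation
  whose right-hand side is locally Lipschitz on \<open>l\<^sup>p \<times> l\<^sup>p\<close>: the discrete Laplacian and the potential
  are bounded, and \<open>\<bar>u\<^sub>n\<bar> \<le> \<parallel>u\<parallel>\<close> makes the power nonlinearity Lipschitz on balls.
  The only properties of the norm that matter are that it bounds each component and that it is lower
  semicontinuous under componentwise limits. The latter gives completeness and also the mean value
  inequality (through Riemann sums), so everything is done componentwise with real calculus.

  Composing the field with the radial retraction onto a ball of radius \<open>R\<close> makes it globally Lipschitz,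
  with a global solution by Picard iteration. The maximal solution is glued from these truncated flows,
  as long as they stay inside their balls; continuous dependence on a compact interval is the
  Gronwall estimate for a single truncated flow.
\<close>

section \<open>Riemann sums and antiderivatives\<close>

text \<open>Two features of the statement shape the setting. The space depends on the numbers
  \<open>p\<close> and \<open>h\<close>, and its members are functions on \<open>real ^ 'd\<close>
  of which only the lattice values count; so \<open>N\<close> is a seminorm on a carrier, and
  equality of solutions means equality on \<open>A\<close>. Moreover, time derivatives are taken
  site by site while continuity is in the norm. Passing from derivatives at sites to estimates in
  the norm is needed three times: for stability, for continuity of the Picard iterates and for their
  contraction.

  These estimates share the weight \<open>exp (2 * L * \<bar>t\<bar>)\<close>. Integrating it gains
  a factor \<open>1 / (2 * L)\<close>, which against the Lipschitz constant \<open>L\<close> leaves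
  1/2. The iteration therefore converges on the whole line, in both directions of time, without
  patching short intervals.

  Truncation also separates lifespan from stability: a perturbed datum has a truncated flow on the
  whole compact interval from the outset, and Gronwall only has to show that this flow stays in the
  ball.\<close>

lemma riemann_sums_tendsto:
  fixes f f' :: "real \<Rightarrow> real"
  assumes "0 \<le> t"
    and der: "\<And>s. s \<in> {0..t} \<Longrightarrow> (f has_real_derivative f' s) (at s within {0..t})"
    and cont: "continuous_on {0..t} f'"
  shows "(\<lambda>m. \<Sum>i<m. t / real m * f' (real i * t / real m)) \<longlonglongrightarrow> f t - f 0"
proof (cases "t = 0")
  case False
  with assms have t: "t > 0" by simp
  show ?thesis
  proof (rule LIMSEQ_I)
    fix r :: real assume "r > 0"
    \<comment> \<open>The cells contribute errors of at most \<open>e\<close> times their lengths,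
      in total \<open>e * t = r / 2\<close>, strictly below \<open>r\<close>.\<close>
    define e where "e = r / (2 * t)"
    have e: "e > 0" using \<open>r > 0\<close> t by (simp add: e_def)
    have "uniformly_continuous_on {0..t} f'"
      using cont compact_uniformly_continuous by blast
    then obtain d where d: "d > 0"
      "\<And>x y. x \<in> {0..t} \<Longrightarrow> y \<in> {0..t} \<Longrightarrow> dist y x < d \<Longrightarrow> dist (f' y) (f' x) < e"
      unfolding uniformly_continuous_on_def using e by metis
    obtain m0 :: nat where m0: "real m0 > t / d" using reals_Archimedean2 by blast
    have "norm ((\<Sum>i<m. t / real m * f' (real i * t / real m)) - (f t - f 0)) < r"
      if "m \<ge> Suc m0" for m
    proof -
      have m: "real m > t / d" "real m > 0" using m0 that by linarith+
      then have md: "t / real m < d" using d(1) by (simp add: field_simps)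
      define p where "p i = real i * t / real m" for i :: nat
      have step: "\<bar>t / real m * f' (p i) - (f (p (Suc i)) - f (p i))\<bar> \<le> e * (t / real m)"
        if "i < m" for i
      proof -
        have diff: "p (Suc i) - p i = t / real m" using m by (simp add: p_def field_simps)
        have le: "p i \<le> p (Suc i)" using diff m t by (smt (verit) divide_nonneg_pos)
        have p0: "0 \<le> p i" using t by (simp add: p_def)
        have "real (Suc i) * t \<le> real m * t" using that t by (intro mult_right_mono) auto
        then have pt: "p (Suc i) \<le> t" using m by (simp add: p_def divide_le_eq mult.commute)
        have sub: "{p i..p (Suc i)} \<subseteq> {0..t}" using p0 pt by auto
        \<comment> \<open>The mean value point lies in the cell, hence within \<open>d\<close> of
          the left endpoint, so uniform continuity compares \<open>f' x\<close> with the sampled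
          value \<open>f' (p i)\<close>.\<close>
        have "\<exists>x\<in>{p i..p (Suc i)}. f (p (Suc i)) - f (p i) = f' x * (p (Suc i) - p i)"
        proof (rule mvt_very_simple[OF le])
          fix x assume "p i \<le> x" "x \<le> p (Suc i)"
          then have "(f has_real_derivative f' x) (at x within {p i..p (Suc i)})"
            using sub by (intro DERIV_subset[OF der sub]) auto
          then show "(f has_derivative (*) (f' x)) (at x within {p i..p (Suc i)})"
            by (simp add: has_field_derivative_def)
        qed
        then obtain x where x: "x \<in> {p i..p (Suc i)}"
          "f (p (Suc i)) - f (p i) = f' x * (t / real m)" using diff by auto
        have "dist x (p i) < d" using x(1) diff md by (auto simp: dist_real_def)
        then have "dist (f' x) (f' (p i)) < e" using d(2) x(1) sub p0 le pt by auto
        then have "\<bar>f' (p i) - f' x\<bar> * (t / real m) \<le> e * (t / real m)"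
          using t m by (intro mult_right_mono) (auto simp: dist_real_def)
        moreover have "t / real m * f' (p i) - (f (p (Suc i)) - f (p i))
            = (f' (p i) - f' x) * (t / real m)" unfolding x(2) by (simp add: algebra_simps)
        ultimately show ?thesis using t m by (simp add: abs_mult)
      qed
      have "(\<Sum>i<m. f (p (Suc i)) - f (p i)) = f t - f 0"
        using m by (subst sum_lessThan_telescope) (simp add: p_def)
      then have "\<bar>(\<Sum>i<m. t / real m * f' (p i)) - (f t - f 0)\<bar>
          = \<bar>\<Sum>i<m. t / real m * f' (p i) - (f (p (Suc i)) - f (p i))\<bar>"
        by (simp only: sum_subtractf)
      also have "\<dots> \<le> (\<Sum>i<m. e * (t / real m))"
        by (rule order_trans[OF sum_abs]) (intro sum_mono step, simp)
      also have "\<dots> = e * t" using m by simp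
      also have "\<dots> < r" using t \<open>r > 0\<close> by (simp add: e_def)
      finally show ?thesis by (simp add: p_def)
    qed
    then show "\<exists>no. \<forall>m\<ge>no. norm ((\<Sum>i<m. t / real m * f' (real i * t / real m)) - (f t - f 0)) < r"
      by blast
  qed
qed simp

text \<open>For continuous \<open>f\<close> this is the integral from 0 to \<open>x\<close>,
  correctly oriented for negative \<open>x\<close> as well.\<close>

definition antideriv :: "(real \<Rightarrow> real) \<Rightarrow> real \<Rightarrow> real" where
  "antideriv f = (SOME G. G 0 = 0 \<and> (\<forall>x. (G has_real_derivative f x) (at x)))"

lemma antideriv:
  assumes "continuous_on UNIV f"
  shows "antideriv f 0 = 0" "(antideriv f has_real_derivative f x) (at x)"
proof -
  have "\<And>x. isCont f x" using assms continuous_on_eq_continuous_at by blast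
  then obtain G where G: "\<And>x::real. (G has_vector_derivative f x) (at x)"
    using einterval_antiderivative[of "-\<infinity>" "\<infinity>" f] by auto
  have "\<exists>G. G 0 = 0 \<and> (\<forall>x. (G has_real_derivative f x) (at x))"
    by (rule exI[of _ "\<lambda>t. G t - G 0"])
      (use G in \<open>auto intro!: derivative_eq_intros simp: has_real_derivative_iff_has_vector_derivative\<close>)
  from someI_ex[OF this] show "antideriv f 0 = 0" "(antideriv f has_real_derivative f x) (at x)"
    by (auto simp: antideriv_def)
qed

section \<open>Mean value inequality for componentwise derivatives\<close>

locale fun_norm =
  fixes A :: "'a set" and X :: "('a \<Rightarrow> real) set" and N :: "('a \<Rightarrow> real) \<Rightarrow> real"
  assumes zero: "(\<lambda>_. 0) \<in> X"
    and add: "u \<in> X \<Longrightarrow> w \<in> X \<Longrightarrow> (\<lambda>n. u n + w n) \<in> X"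
    and scale: "u \<in> X \<Longrightarrow> (\<lambda>n. c * u n) \<in> X"
    and N_add: "u \<in> X \<Longrightarrow> w \<in> X \<Longrightarrow> N (\<lambda>n. u n + w n) \<le> N u + N w"
    and N_scale: "u \<in> X \<Longrightarrow> N (\<lambda>n. c * u n) = \<bar>c\<bar> * N u"
    and pointwise: "u \<in> X \<Longrightarrow> n \<in> A \<Longrightarrow> \<bar>u n\<bar> \<le> N u"
    and fatou: "(\<And>k::nat. us k \<in> X) \<Longrightarrow> (\<And>k. N (us k) \<le> C) \<Longrightarrow>
      (\<And>n. n \<in> A \<Longrightarrow> (\<lambda>k. us k n) \<longlonglongrightarrow> w n) \<Longrightarrow> w \<in> X \<and> N w \<le> C"
begin

section \<open>Inequalities for the seminorm and its distance\<close>

definition D :: "('a \<Rightarrow> real) \<Rightarrow> ('a \<Rightarrow> real) \<Rightarrow> real" where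
  "D u w = N (\<lambda>n. u n - w n)"

lemma diff: "u \<in> X \<Longrightarrow> w \<in> X \<Longrightarrow> (\<lambda>n. u n - w n) \<in> X"
  using add[of u "\<lambda>n. -1 * w n"] scale[of w "-1"] by simp

lemma N_zero: "N (\<lambda>_. 0) = 0"
  using N_scale[OF zero, of 0] by simp

lemma N_minus: "u \<in> X \<Longrightarrow> N (\<lambda>n. - u n) = N u"
  using N_scale[of u "-1"] by simp

lemma N_nonneg: "u \<in> X \<Longrightarrow> 0 \<le> N u"
  using N_add[of u "\<lambda>n. -1 * u n"] scale[of u "-1"] N_minus[of u] N_zero by simp

lemma D_nonneg: "u \<in> X \<Longrightarrow> w \<in> X \<Longrightarrow> 0 \<le> D u w"
  by (simp add: D_def N_nonneg diff)

lemma D_sym: "u \<in> X \<Longrightarrow> w \<in> X \<Longrightarrow> D u w = D w u"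
  unfolding D_def using N_minus[OF diff, of u w] by simp

lemma D_triangle: "u \<in> X \<Longrightarrow> v \<in> X \<Longrightarrow> w \<in> X \<Longrightarrow> D u w \<le> D u v + D v w"
  unfolding D_def using N_add[OF diff diff, of u v v w] by simp

lemma N_le_D: "u \<in> X \<Longrightarrow> w \<in> X \<Longrightarrow> N u \<le> N w + D u w"
  unfolding D_def using N_add[of w "\<lambda>n. u n - w n"] diff[of u w] by simp

lemma N_diff_le_D: "u \<in> X \<Longrightarrow> w \<in> X \<Longrightarrow> \<bar>N u - N w\<bar> \<le> D u w"
  using N_le_D[of u w] N_le_D[of w u] D_sym[of u w] by simp

lemma D_self: "D u u = 0"
  by (simp add: D_def N_zero)

lemma D_pointwise: "u \<in> X \<Longrightarrow> w \<in> X \<Longrightarrow> n \<in> A \<Longrightarrow> \<bar>u n - w n\<bar> \<le> D u w"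
  unfolding D_def using pointwise[OF diff] by simp

lemma eq_if_D_le_0: "u \<in> X \<Longrightarrow> w \<in> X \<Longrightarrow> D u w \<le> 0 \<Longrightarrow> n \<in> A \<Longrightarrow> u n = w n"
  using D_pointwise[of u w n] by simp

text \<open>A constant sequence converges at each point of \<open>A\<close> to any function agreeing
  with it there. So \<open>fatou\<close> already contains the fact that values off \<open>A\<close>
  are invisible to \<open>X\<close> and, in \<open>N_cong\<close>, to \<open>N\<close>.\<close>

lemma mem_cong:
  assumes "u \<in> X" "\<And>n. n \<in> A \<Longrightarrow> u n = w n" shows "w \<in> X"
  using fatou[of "\<lambda>_. u" "N u" w] assms by simp

lemma N_cong:
  assumes "u \<in> X" "\<And>n. n \<in> A \<Longrightarrow> u n = w n" shows "N u = N w"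
  using fatou[of "\<lambda>_. u" "N u" w] fatou[of "\<lambda>_. w" "N w" u] assms mem_cong[OF assms] by (simp add: order_antisym)

text \<open>A tail of the sequence is bounded by \<open>C + e\<close>, so \<open>fatou\<close>
  applies to that tail, and then \<open>e\<close> tends to 0. Bounds that vary with \<open>k\<close>
  are what Riemann sums and subsequences provide.\<close>

lemma fatou_tendsto:
  assumes "\<And>k::nat. us k \<in> X" "\<And>k. N (us k) \<le> c k" "c \<longlonglongrightarrow> C"
    "\<And>n. n \<in> A \<Longrightarrow> (\<lambda>k. us k n) \<longlonglongrightarrow> w n"
  shows "w \<in> X" "N w \<le> C"
proof -
  have *: "w \<in> X \<and> N w \<le> C + e" if "e > 0" for e
  proof -
    have "eventually (\<lambda>k. c k < C + e) sequentially"
      using assms(3) that by (intro order_tendstoD(2)[OF assms(3)]) simp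
    then obtain k0 where k0: "\<And>k. k \<ge> k0 \<Longrightarrow> c k < C + e"
      by (auto simp: eventually_sequentially)
    show ?thesis
    proof (rule fatou[of "\<lambda>k. us (k + k0)"])
      show "N (us (k + k0)) \<le> C + e" for k using assms(2)[of "k + k0"] k0[of "k + k0"] by simp
      show "(\<lambda>k. us (k + k0) n) \<longlonglongrightarrow> w n" if "n \<in> A" for n
        using LIMSEQ_ignore_initial_segment[OF assms(4)[OF that]] by simp
    qed (use assms in auto)
  qed
  show "w \<in> X" using *[of 1] by simp
  show "N w \<le> C" using * by (meson field_le_epsilon)
qed

lemma sum_mem_N_le:
  assumes "finite I" "\<And>i. i \<in> I \<Longrightarrow> us i \<in> X"
  shows "(\<lambda>n. \<Sum>i\<in>I. us i n) \<in> X \<and> N (\<lambda>n. \<Sum>i\<in>I. us i n) \<le> (\<Sum>i\<in>I. N (us i))"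
  using assms
proof (induction I rule: finite_induct)
  case (insert m I)
  then have IH: "(\<lambda>n. \<Sum>i\<in>I. us i n) \<in> X" "N (\<lambda>n. \<Sum>i\<in>I. us i n) \<le> (\<Sum>i\<in>I. N (us i))"
    and um: "us m \<in> X" by auto
  show ?case using add[OF um IH(1)] N_add[OF um IH(1)] IH(2) insert.hyps by simp
qed (simp add: zero N_zero)

text \<open>The increment of \<^term>\<open>w\<close> is a pointwise limit of Riemann sums of \<^term>\<open>w'\<close>, to which the
  triangle inequality applies; no vector-valued integral is needed.\<close>

lemma mean_value_pos:
  assumes "0 \<le> t"
    and mem: "\<And>s. s \<in> {0..t} \<Longrightarrow> w' s \<in> X"
    and der: "\<And>s n. s \<in> {0..t} \<Longrightarrow> n \<in> A \<Longrightarrow> ((\<lambda>s. w s n) has_real_derivative w' s n) (at s within {0..t})"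
    and cont: "\<And>n. n \<in> A \<Longrightarrow> continuous_on {0..t} (\<lambda>s. w' s n)"
    and bound: "\<And>s. s \<in> {0..t} \<Longrightarrow> N (w' s) \<le> \<phi>' s"
    and der_phi: "\<And>s. s \<in> {0..t} \<Longrightarrow> (\<phi> has_real_derivative \<phi>' s) (at s within {0..t})"
    and cont_phi: "continuous_on {0..t} \<phi>'"
  shows "(\<lambda>n. w t n - w 0 n) \<in> X" "N (\<lambda>n. w t n - w 0 n) \<le> \<phi> t - \<phi> 0"
proof -
  define S where "S m n = (\<Sum>i<m. t / real m * w' (real i * t / real m) n)" for m :: nat and n
  have in_seg: "real i * t / real m \<in> {0..t}" if "i < m" for i m :: nat
  proof -
    have "real i * t \<le> real m * t" using that assms(1) by (intro mult_right_mono) auto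
    then show ?thesis using that assms(1) by (auto simp: divide_le_eq mult.commute)
  qed
  have S: "S m \<in> X \<and> N (S m) \<le> (\<Sum>i<m. t / real m * \<phi>' (real i * t / real m))" for m
  proof -
    have "(\<lambda>n. t / real m * w' (real i * t / real m) n) \<in> X" if "i < m" for i
      by (rule scale[OF mem[OF in_seg[OF that]]])
    then have *: "(\<lambda>n. \<Sum>i<m. t / real m * w' (real i * t / real m) n) \<in> X \<and>
        N (\<lambda>n. \<Sum>i<m. t / real m * w' (real i * t / real m) n)
          \<le> (\<Sum>i<m. N (\<lambda>n. t / real m * w' (real i * t / real m) n))"
      by (intro sum_mem_N_le) auto
    have "N (\<lambda>n. t / real m * w' (real i * t / real m) n) \<le> t / real m * \<phi>' (real i * t / real m)"
      if "i < m" for i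
      unfolding N_scale[OF mem[OF in_seg[OF that]]] using assms(1) bound[OF in_seg[OF that]]
      by (auto intro!: mult_left_mono simp del: times_divide_eq_left)
    then have "(\<Sum>i<m. N (\<lambda>n. t / real m * w' (real i * t / real m) n))
        \<le> (\<Sum>i<m. t / real m * \<phi>' (real i * t / real m))" by (intro sum_mono) simp
    moreover have "S m = (\<lambda>n. \<Sum>i<m. t / real m * w' (real i * t / real m) n)"
      by (simp add: S_def fun_eq_iff)
    ultimately show ?thesis using * by simp
  qed
  have "(\<lambda>m. S m n) \<longlonglongrightarrow> w t n - w 0 n" if "n \<in> A" for n
    unfolding S_def using riemann_sums_tendsto[OF assms(1) der[OF _ that] cont[OF that]] by simp
  from fatou_tendsto[OF _ _ riemann_sums_tendsto[OF assms(1) der_phi cont_phi] this] S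
  show "(\<lambda>n. w t n - w 0 n) \<in> X" "N (\<lambda>n. w t n - w 0 n) \<le> \<phi> t - \<phi> 0" by auto
qed

text \<open>For negative \<open>t\<close> the curve is reflected to
  \<open>\<lambda>s. w (- s)\<close>. With the majorant taken at \<open>\<bar>s\<bar>\<close>, one
  bound serves both directions of time, and no absolute value has to be differentiated.\<close>

lemma mean_value:
  assumes mem: "\<And>s. s \<in> closed_segment 0 t \<Longrightarrow> w' s \<in> X"
    and der: "\<And>s n. s \<in> closed_segment 0 t \<Longrightarrow> n \<in> A \<Longrightarrow>
      ((\<lambda>s. w s n) has_real_derivative w' s n) (at s within closed_segment 0 t)"
    and cont: "\<And>n. n \<in> A \<Longrightarrow> continuous_on (closed_segment 0 t) (\<lambda>s. w' s n)"
    and bound: "\<And>s. s \<in> closed_segment 0 t \<Longrightarrow> N (w' s) \<le> \<phi>' \<bar>s\<bar>"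
    and der_phi: "\<And>s. (\<phi> has_real_derivative \<phi>' s) (at s)"
    and cont_phi: "continuous_on UNIV \<phi>'"
  shows "(\<lambda>n. w t n - w 0 n) \<in> X" "N (\<lambda>n. w t n - w 0 n) \<le> \<phi> \<bar>t\<bar> - \<phi> 0"
proof -
  have *: "(\<lambda>n. w t n - w 0 n) \<in> X \<and> N (\<lambda>n. w t n - w 0 n) \<le> \<phi> \<bar>t\<bar> - \<phi> 0"
  proof (cases "0 \<le> t")
    case True
    then have seg: "closed_segment 0 t = {0..t}" by (simp add: closed_segment_eq_real_ivl)
    show ?thesis
      using mean_value_pos[of t w' w \<phi>' \<phi>] assms[unfolded seg] True
        has_field_derivative_at_within[OF der_phi] continuous_on_subset[OF cont_phi]
      by auto
  next
    case False
    then have seg: "closed_segment 0 t = {t..0}" by (simp add: closed_segment_eq_real_ivl)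
    have im: "uminus ` {0..-t} = {t..0}" by simp
    have d: "((\<lambda>s. w (- s) n) has_real_derivative - w' (- s) n) (at s within {0..-t})"
      if "s \<in> {0..-t}" "n \<in> A" for s n
    proof -
      have "((\<lambda>s. w s n) has_real_derivative w' (- s) n) (at (- s) within uminus ` {0..-t})"
        using der[of "- s" n] that unfolding seg im by simp
      moreover have "(uminus has_real_derivative -1) (at s within {0..-t})"
        by (auto intro!: derivative_eq_intros)
      ultimately show ?thesis
        using DERIV_image_chain[of "\<lambda>s. w s n" "w' (- s) n" uminus s "{0..-t}" "-1"] by (simp add: o_def)
    qed
    have c: "continuous_on {0..-t} (\<lambda>s. - w' (- s) n)" if "n \<in> A" for n
      using cont[OF that] unfolding seg
      by (intro continuous_intros continuous_on_compose2[of "{t..0}" "\<lambda>s. w' s n" "{0..-t}" uminus]) auto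
    have m: "(\<lambda>n. - w' (- s) n) \<in> X \<and> N (\<lambda>n. - w' (- s) n) \<le> \<phi>' s" if "s \<in> {0..-t}" for s
      using mem[of "- s"] bound[of "- s"] that scale[of "w' (- s)" "-1"] N_minus[of "w' (- s)"]
      unfolding seg by auto
    show ?thesis
      using mean_value_pos[of "-t" "\<lambda>s n. - w' (- s) n" "\<lambda>s. w (- s)" \<phi>' \<phi>] d c m False
        has_field_derivative_at_within[OF der_phi] continuous_on_subset[OF cont_phi]
      by (auto simp: atLeastAtMost_def)
  qed
  then show "(\<lambda>n. w t n - w 0 n) \<in> X" "N (\<lambda>n. w t n - w 0 n) \<le> \<phi> \<bar>t\<bar> - \<phi> 0" by auto
qed

end

section \<open>Globally Lipschitz fields\<close>

lemma tendsto_0_le_within: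
  fixes f g :: "'b::topological_space \<Rightarrow> real"
  assumes "(g \<longlongrightarrow> 0) (at t within J)" "\<And>s. s \<in> J \<Longrightarrow> \<bar>f s\<bar> \<le> g s"
  shows "(f \<longlongrightarrow> 0) (at t within J)"
  by (rule Lim_null_comparison[OF _ assms(1)]) (use assms(2) in \<open>auto simp: eventually_at_filter\<close>)

definition picard_step ::
  "(('a \<Rightarrow> real) \<Rightarrow> 'a \<Rightarrow> real) \<Rightarrow> ('a \<Rightarrow> real) \<Rightarrow> (real \<Rightarrow> 'a \<Rightarrow> real) \<Rightarrow> real \<Rightarrow> 'a \<Rightarrow> real" where
  "picard_step F x0 x t n = x0 n + antideriv (\<lambda>s. F (x s) n) t"

context fun_norm
begin

section \<open>Curves that are continuous in the norm\<close>

definition norm_continuous_on :: "real set \<Rightarrow> (real \<Rightarrow> 'a \<Rightarrow> real) \<Rightarrow> bool" where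
  "norm_continuous_on J x \<longleftrightarrow>
     (\<forall>t\<in>J. x t \<in> X) \<and> (\<forall>t\<in>J. ((\<lambda>s. D (x s) (x t)) \<longlongrightarrow> 0) (at t within J))"

definition solves :: "(('a \<Rightarrow> real) \<Rightarrow> 'a \<Rightarrow> real) \<Rightarrow> real set \<Rightarrow> (real \<Rightarrow> 'a \<Rightarrow> real) \<Rightarrow> bool" where
  "solves F J x \<longleftrightarrow> norm_continuous_on J x \<and>
     (\<forall>t\<in>J. \<forall>n\<in>A. ((\<lambda>s. x s n) has_real_derivative F (x t) n) (at t within J))"

definition lipschitz_map :: "real \<Rightarrow> (('a \<Rightarrow> real) \<Rightarrow> 'a \<Rightarrow> real) \<Rightarrow> bool" where
  "lipschitz_map L F \<longleftrightarrow> (\<forall>x\<in>X. F x \<in> X) \<and> (\<forall>x\<in>X. \<forall>y\<in>X. D (F x) (F y) \<le> L * D x y)"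

lemma norm_continuous_on_mem: "norm_continuous_on J x \<Longrightarrow> t \<in> J \<Longrightarrow> x t \<in> X"
  by (simp add: norm_continuous_on_def)

lemma norm_continuous_on_subset: "norm_continuous_on J x \<Longrightarrow> I \<subseteq> J \<Longrightarrow> norm_continuous_on I x"
  unfolding norm_continuous_on_def by (meson subset_iff tendsto_within_subset)

lemma solves_subset: "solves F J x \<Longrightarrow> I \<subseteq> J \<Longrightarrow> solves F I x"
  unfolding solves_def by (meson DERIV_subset norm_continuous_on_subset subset_iff)

lemma norm_continuous_on_const: "u \<in> X \<Longrightarrow> norm_continuous_on J (\<lambda>_. u)"
  by (simp add: norm_continuous_on_def D_self)

lemma norm_continuous_on_continuous_on:
  assumes "norm_continuous_on J x"
    and "\<And>s t. s \<in> J \<Longrightarrow> t \<in> J \<Longrightarrow> \<bar>f s - f t\<bar> \<le> D (x s) (x t)"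
  shows "continuous_on J (f :: real \<Rightarrow> real)"
  unfolding continuous_on_def
proof (rule ballI, rule LIM_zero_cancel)
  fix t assume "t \<in> J"
  with assms show "((\<lambda>s. f s - f t) \<longlongrightarrow> 0) (at t within J)"
    by - (rule tendsto_0_le_within[of "\<lambda>s. D (x s) (x t)"], auto simp: norm_continuous_on_def)
qed

lemma continuous_on_N: "norm_continuous_on J x \<Longrightarrow> continuous_on J (\<lambda>t. N (x t))"
  by (rule norm_continuous_on_continuous_on) (auto intro: N_diff_le_D norm_continuous_on_mem)

lemma continuous_on_component:
  "norm_continuous_on J x \<Longrightarrow> n \<in> A \<Longrightarrow> continuous_on J (\<lambda>t. x t n)"
  by (rule norm_continuous_on_continuous_on) (auto intro: D_pointwise norm_continuous_on_mem)

lemma D_diff_le: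
  assumes "a \<in> X" "b \<in> X" "c \<in> X" "d \<in> X"
  shows "D (\<lambda>n. a n - b n) (\<lambda>n. c n - d n) \<le> D a c + D b d"
proof -
  have "D (\<lambda>n. a n - b n) (\<lambda>n. c n - d n) = N (\<lambda>n. (a n - c n) + (d n - b n))"
    unfolding D_def by (rule arg_cong[of _ _ N]) auto
  also have "\<dots> \<le> D a c + D d b"
    unfolding D_def using assms by (intro N_add diff) auto
  finally show ?thesis using assms by (simp add: D_sym)
qed

lemma norm_continuous_on_diff:
  assumes "norm_continuous_on J x" "norm_continuous_on J y"
  shows "norm_continuous_on J (\<lambda>t n. x t n - y t n)"
  unfolding norm_continuous_on_def
proof (intro conjI ballI)
  fix t assume t: "t \<in> J"
  show "(\<lambda>n. x t n - y t n) \<in> X" using assms t by (intro diff norm_continuous_on_mem)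
  have "((\<lambda>s. D (x s) (x t) + D (y s) (y t)) \<longlongrightarrow> 0 + 0) (at t within J)"
    using assms t by (intro tendsto_add) (auto simp: norm_continuous_on_def)
  moreover have "\<bar>D (\<lambda>n. x s n - y s n) (\<lambda>n. x t n - y t n)\<bar> \<le> D (x s) (x t) + D (y s) (y t)"
    if "s \<in> J" for s
  proof -
    note mem = assms[THEN norm_continuous_on_mem, OF that] assms[THEN norm_continuous_on_mem, OF t]
    show ?thesis
      using D_diff_le[OF mem] D_nonneg[OF diff[OF mem(1,2)] diff[OF mem(3,4)]] by linarith
  qed
  ultimately show "((\<lambda>s. D (\<lambda>n. x s n - y s n) (\<lambda>n. x t n - y t n)) \<longlongrightarrow> 0) (at t within J)"
    by - (rule tendsto_0_le_within[of "\<lambda>s. D (x s) (x t) + D (y s) (y t)"], simp_all)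
qed

lemma continuous_on_D:
  "norm_continuous_on J x \<Longrightarrow> norm_continuous_on J y \<Longrightarrow> continuous_on J (\<lambda>t. D (x t) (y t))"
  unfolding D_def by (intro continuous_on_N norm_continuous_on_diff)

lemma norm_continuous_on_lipschitz_map:
  assumes "lipschitz_map L F" "norm_continuous_on J x"
  shows "norm_continuous_on J (\<lambda>t. F (x t))"
  unfolding norm_continuous_on_def
proof (intro conjI ballI)
  fix t assume t: "t \<in> J"
  show "F (x t) \<in> X" using assms t by (auto simp: lipschitz_map_def norm_continuous_on_mem)
  have "((\<lambda>s. L * D (x s) (x t)) \<longlongrightarrow> L * 0) (at t within J)"
    using assms t by (intro tendsto_mult_left) (auto simp: norm_continuous_on_def)
  moreover have "\<bar>D (F (x s)) (F (x t))\<bar> \<le> L * D (x s) (x t)" if "s \<in> J" for s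
  proof -
    note mem = norm_continuous_on_mem[OF assms(2) that] norm_continuous_on_mem[OF assms(2) t]
    have "F (x s) \<in> X" "F (x t) \<in> X" "D (F (x s)) (F (x t)) \<le> L * D (x s) (x t)"
      using assms(1) mem by (auto simp: lipschitz_map_def)
    then show ?thesis using D_nonneg[of "F (x s)" "F (x t)"] by linarith
  qed
  ultimately show "((\<lambda>s. D (F (x s)) (F (x t))) \<longlongrightarrow> 0) (at t within J)"
    by - (rule tendsto_0_le_within[of "\<lambda>s. L * D (x s) (x t)"], simp_all)
qed

lemma norm_continuous_on_bounded:
  assumes "norm_continuous_on {a..b} x"
  shows "\<exists>C\<ge>0. \<forall>t\<in>{a..b}. N (x t) \<le> C"
proof -
  have "compact ((\<lambda>t. N (x t)) ` {a..b})"
    by (intro compact_continuous_image continuous_on_N assms) simp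
  then have "bounded ((\<lambda>t. N (x t)) ` {a..b})" by (rule compact_imp_bounded)
  then obtain C where "\<forall>t\<in>{a..b}. \<bar>N (x t)\<bar> \<le> C"
    unfolding bounded_iff by auto
  then have "N (x t) \<le> \<bar>C\<bar>" if "t \<in> {a..b}" for t
    using that by (meson abs_ge_self order_trans)
  then show ?thesis by (intro exI[of _ "\<bar>C\<bar>"] conjI ballI abs_ge_zero)
qed

text \<open>Gronwall's inequality with a factor 2 lost: the largest value of
  \<^term>\<open>D (x s) (y s) * exp (- 2 * L * \<bar>s\<bar>)\<close> is estimated by the initial distance plus half of itself.\<close>

lemma lipschitz_stability:
  assumes F: "lipschitz_map L F" and L: "L > 0"
    and x: "solves F J x" and y: "solves F J y"
    and J: "is_interval J" "0 \<in> J" and t: "t \<in> J"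
  shows "D (x t) (y t) \<le> 2 * D (x 0) (y 0) * exp (2 * L * \<bar>t\<bar>)"
proof -
  have seg: "closed_segment 0 s \<subseteq> J" if "s \<in> J" for s
    using J that by (meson closed_segment_subset is_interval_convex_1)
  have xc: "norm_continuous_on J x" and yc: "norm_continuous_on J y"
    using x y by (auto simp: solves_def)
  define E where "E s = exp (2 * L * \<bar>s\<bar>)" for s
  define m where "m s = D (x s) (y s) / E s" for s
  have Epos: "E s > 0" for s by (simp add: E_def)
  have "continuous_on (closed_segment 0 t) m"
    unfolding m_def E_def
    by (intro continuous_intros continuous_on_subset[OF continuous_on_D[OF xc yc] seg[OF t]]) auto
  then obtain s0 where s0: "s0 \<in> closed_segment 0 t"
    and max: "\<And>s. s \<in> closed_segment 0 t \<Longrightarrow> m s \<le> m s0"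
    using continuous_attains_sup[OF compact_segment, of 0 t m] by auto
  have s0J: "s0 \<in> J" using s0 seg[OF t] by auto
  have sub: "closed_segment 0 s0 \<subseteq> J" using seg s0J by auto
  have sub': "closed_segment 0 s0 \<subseteq> closed_segment 0 t"
    using s0 by (simp add: subset_closed_segment)
  have mem: "x s \<in> X" "y s \<in> X" "F (x s) \<in> X" "F (y s) \<in> X" if "s \<in> J" for s
    using F norm_continuous_on_mem[OF xc that] norm_continuous_on_mem[OF yc that]
    by (auto simp: lipschitz_map_def)
  have K: "m s0 \<ge> 0" using s0J mem Epos by (simp add: m_def D_nonneg less_imp_le)
  \<comment> \<open>By maximality of \<open>m s0\<close>, the velocities at time \<open>s\<close>
    differ by at most \<open>L * m s0 * exp (2 * L * \<bar>s\<bar>)\<close>. The exponent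
    \<open>2 * L\<close> is chosen so that integration leaves the factor 1/2.\<close>
  have "N (\<lambda>n. (x s0 n - y s0 n) - (x 0 n - y 0 n))
      \<le> m s0 / 2 * exp (2 * L * \<bar>s0\<bar>) - m s0 / 2 * exp (2 * L * 0)"
  proof (rule mean_value(2)[where w' = "\<lambda>s n. F (x s) n - F (y s) n"
        and \<phi>' = "\<lambda>r. L * m s0 * exp (2 * L * r)"])
    fix s assume s: "s \<in> closed_segment 0 s0"
    then have sJ: "s \<in> J" using sub by auto
    show "(\<lambda>n. F (x s) n - F (y s) n) \<in> X" using mem[OF sJ] by (intro diff)
    show "((\<lambda>s. x s n - y s n) has_real_derivative F (x s) n - F (y s) n) (at s within closed_segment 0 s0)"
      if "n \<in> A" for n
      using solves_subset[OF x sub] solves_subset[OF y sub] s that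
      by (auto simp: solves_def intro!: DERIV_diff)
    have "N (\<lambda>n. F (x s) n - F (y s) n) \<le> L * D (x s) (y s)"
      using F mem[OF sJ] by (auto simp: lipschitz_map_def D_def)
    also have "D (x s) (y s) \<le> m s0 * E s"
      using max[of s] s sub' Epos[of s] by (auto simp: m_def divide_le_eq)
    finally show "N (\<lambda>n. F (x s) n - F (y s) n) \<le> L * m s0 * exp (2 * L * \<bar>s\<bar>)"
      using L by (simp add: E_def mult.assoc)
  next
    fix n assume n: "n \<in> A"
    show "continuous_on (closed_segment 0 s0) (\<lambda>s. F (x s) n - F (y s) n)"
      by (intro continuous_intros continuous_on_subset[OF _ sub] continuous_on_component[OF _ n]
          norm_continuous_on_lipschitz_map[OF F] xc yc)
  qed (auto intro!: derivative_eq_intros continuous_intros)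
  moreover have "D (x s0) (y s0) \<le> D (x 0) (y 0) + N (\<lambda>n. (x s0 n - y s0 n) - (x 0 n - y 0 n))"
    using N_le_D[OF diff diff, of "x s0" "y s0" "x 0" "y 0"] mem[OF s0J] mem[OF J(2)]
    by (simp add: D_def)
  moreover have "D (x s0) (y s0) = m s0 * E s0" using Epos[of s0] by (simp add: m_def)
  \<comment> \<open>Half of \<open>m s0 * E s0\<close> is absorbed on the left; the term
    \<open>- m s0 / 2\<close> from the lower endpoint has the favourable sign.\<close>
  ultimately have "m s0 * E s0 \<le> 2 * D (x 0) (y 0)" using K by (simp add: E_def)
  moreover have "m s0 * 1 \<le> m s0 * E s0" using K L by (intro mult_left_mono) (auto simp: E_def)
  moreover have "m t \<le> m s0" by (intro max) simp
  ultimately have "m t \<le> 2 * D (x 0) (y 0)" by simp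
  then have "m t * E t \<le> 2 * D (x 0) (y 0) * E t"
    using Epos[of t] by (intro mult_right_mono) simp_all
  moreover have "m t * E t = D (x t) (y t)" using Epos[of t] by (simp add: m_def)
  ultimately show ?thesis by (simp only: E_def)
qed

section \<open>Picard iteration in an exponentially weighted distance\<close>

lemma picard_step_deriv:
  assumes F: "lipschitz_map L F" and x: "norm_continuous_on UNIV x" and n: "n \<in> A"
  shows "((\<lambda>s. picard_step F x0 x s n) has_real_derivative F (x t) n) (at t)"
    and "picard_step F x0 x 0 n = x0 n"
proof -
  note c = continuous_on_component[OF norm_continuous_on_lipschitz_map[OF F x] n]
  show "((\<lambda>s. picard_step F x0 x s n) has_real_derivative F (x t) n) (at t)"
    unfolding picard_step_def using DERIV_add[OF DERIV_const antideriv(2)[OF c]] by simp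
  show "picard_step F x0 x 0 n = x0 n"
    by (simp add: picard_step_def antideriv(1)[OF c])
qed

text \<open>The iterate is built site by site, so even its membership in \<open>X\<close> needs
  proof. Membership and continuity both come from \<open>mean_value\<close>, applied to the curve
  translated by \<open>t\<close> because its base point is time 0, with a bound for the field on a
  compact interval.\<close>

lemma picard_step_continuous:
  assumes F: "lipschitz_map L F" and x: "norm_continuous_on UNIV x" and x0: "x0 \<in> X"
  shows "norm_continuous_on UNIV (picard_step F x0 x)"
proof -
  let ?y = "picard_step F x0 x"
  have Fx: "norm_continuous_on UNIV (\<lambda>t. F (x t))" by (rule norm_continuous_on_lipschitz_map[OF F x])
  have inc: "(\<lambda>n. ?y s n - ?y t n) \<in> X \<and> N (\<lambda>n. ?y s n - ?y t n) \<le> C * \<bar>s - t\<bar>"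
    if C: "\<And>r. r \<in> closed_segment s t \<Longrightarrow> N (F (x r)) \<le> C" for s t C
  proof -
    have shift: "r + t \<in> closed_segment s t" if "r \<in> closed_segment 0 (s - t)" for r
      using that by (auto simp: closed_segment_eq_real_ivl split: if_splits)
    have der: "((\<lambda>s. ?y (s + t) n) has_real_derivative F (x (r + t)) n) (at r within J)"
      if "n \<in> A" for n r J
      using picard_step_deriv(1)[OF F x that, of x0 "r + t"]
      by - (rule has_field_derivative_at_within, rule DERIV_shift[THEN iffD1])
    have cont: "continuous_on J (\<lambda>r. F (x (r + t)) n)" if "n \<in> A" for n J
      by (rule continuous_on_compose2[OF continuous_on_component[OF Fx that]])
         (auto intro!: continuous_intros)
    have bound: "N (F (x (r + t))) \<le> C" if "r \<in> closed_segment 0 (s - t)" for r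
      using C shift[OF that] .
    have mem: "F (x r) \<in> X" for r using norm_continuous_on_mem[OF Fx] by simp
    have der_lin: "((\<lambda>r. C * r) has_real_derivative C) (at r)" for r
      by (auto intro!: derivative_eq_intros)
    have "(\<lambda>n. ?y (s - t + t) n - ?y (0 + t) n) \<in> X"
      "N (\<lambda>n. ?y (s - t + t) n - ?y (0 + t) n) \<le> C * \<bar>s - t\<bar> - C * 0"
      using mean_value[where w = "\<lambda>s. ?y (s + t)" and w' = "\<lambda>r. F (x (r + t))" and \<phi>' = "\<lambda>_. C",
          OF mem der cont bound der_lin continuous_on_const]
      by blast+
    then show ?thesis by simp
  qed
  have bd: "\<exists>C\<ge>0. \<forall>r\<in>{a..b}. N (F (x r)) \<le> C" for a b
    by (rule norm_continuous_on_bounded[OF norm_continuous_on_subset[OF Fx]]) simp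
  have mem: "?y t \<in> X" for t
  proof -
    obtain C where "\<forall>r\<in>{- \<bar>t\<bar>..\<bar>t\<bar>}. N (F (x r)) \<le> C" using bd by blast
    then have "(\<lambda>n. ?y t n - ?y 0 n) \<in> X"
      by (intro conjunct1[OF inc]) (auto simp: closed_segment_eq_real_ivl split: if_splits)
    then have "(\<lambda>n. (?y t n - ?y 0 n) + x0 n) \<in> X" using x0 by (rule add)
    then show ?thesis by (rule mem_cong) (simp add: picard_step_deriv(2)[OF F x])
  qed
  show ?thesis
    unfolding norm_continuous_on_def
  proof (intro conjI ballI mem)
    fix t :: real
    obtain C where C: "C \<ge> 0" "\<forall>r\<in>{t - 1..t + 1}. N (F (x r)) \<le> C" using bd by blast
    have "((\<lambda>s. C * \<bar>s - t\<bar>) \<longlongrightarrow> C * \<bar>t - t\<bar>) (at t)" by (intro tendsto_intros)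
    moreover have "\<forall>\<^sub>F s in at t. norm (D (?y s) (?y t)) \<le> C * \<bar>s - t\<bar>"
      unfolding eventually_at
    proof (intro exI[of _ 1] conjI ballI impI)
      fix s assume "s \<noteq> t \<and> dist s t < 1"
      then have "N (\<lambda>n. ?y s n - ?y t n) \<le> C * \<bar>s - t\<bar>"
        using C(2) by (intro conjunct2[OF inc])
          (auto simp: closed_segment_eq_real_ivl dist_real_def split: if_splits)
      then show "norm (D (?y s) (?y t)) \<le> C * \<bar>s - t\<bar>"
        using D_nonneg[OF mem mem] by (simp add: D_def)
    qed simp
    ultimately show "((\<lambda>s. D (?y s) (?y t)) \<longlongrightarrow> 0) (at t)"
      by - (rule Lim_null_comparison[where g = "\<lambda>s. C * \<bar>s - t\<bar>"], simp_all)
  qed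
qed

text \<open>Integration divides the weight by \<open>2 * L\<close> and the field multiplies by
  \<open>L\<close>, so one step halves \<open>K\<close>. With the growing weight this holds at all
  times, not just at short ones; the contribution of the lower endpoint is \<open>- K / 2\<close>
  and is dropped.\<close>

lemma picard_step_contract:
  assumes F: "lipschitz_map L F" and L: "L > 0" and x0: "x0 \<in> X"
    and x: "norm_continuous_on UNIV x" and y: "norm_continuous_on UNIV y"
    and le: "\<And>s. D (x s) (y s) \<le> K * exp (2 * L * \<bar>s\<bar>)" and K: "K \<ge> 0"
  shows "D (picard_step F x0 x t) (picard_step F x0 y t) \<le> K / 2 * exp (2 * L * \<bar>t\<bar>)"
proof -
  let ?w = "\<lambda>t n. picard_step F x0 x t n - picard_step F x0 y t n"
  note Fx = norm_continuous_on_lipschitz_map[OF F x] and Fy = norm_continuous_on_lipschitz_map[OF F y]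
  note m = norm_continuous_on_mem[OF _ UNIV_I]
  note deriv = picard_step_deriv(1)[OF F x] picard_step_deriv(1)[OF F y]
  have "N (\<lambda>n. ?w t n - ?w 0 n) \<le> K / 2 * exp (2 * L * \<bar>t\<bar>) - K / 2 * exp (2 * L * 0)"
  proof (rule mean_value(2)[where w' = "\<lambda>s n. F (x s) n - F (y s) n"
        and \<phi>' = "\<lambda>r. L * K * exp (2 * L * r)"])
    fix s
    show "(\<lambda>n. F (x s) n - F (y s) n) \<in> X" using m[OF Fx] m[OF Fy] by (intro diff)
    have "N (\<lambda>n. F (x s) n - F (y s) n) \<le> L * D (x s) (y s)"
      using F m[OF x] m[OF y] by (auto simp: lipschitz_map_def D_def)
    also have "\<dots> \<le> L * (K * exp (2 * L * \<bar>s\<bar>))" using L le by (intro mult_left_mono) auto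
    finally show "N (\<lambda>n. F (x s) n - F (y s) n) \<le> L * K * exp (2 * L * \<bar>s\<bar>)" by (simp add: mult.assoc)
    show "((\<lambda>s. ?w s n) has_real_derivative F (x s) n - F (y s) n) (at s within closed_segment 0 t)"
      if "n \<in> A" for n
      using deriv[OF that] by - (rule has_field_derivative_at_within, rule DERIV_diff)
  next
    fix n assume n: "n \<in> A"
    show "continuous_on (closed_segment 0 t) (\<lambda>s. F (x s) n - F (y s) n)"
      using continuous_on_component[OF Fx n] continuous_on_component[OF Fy n]
      by (intro continuous_intros) (auto intro: continuous_on_subset)
  qed (auto intro!: derivative_eq_intros continuous_intros)
  moreover have "N (?w t) = N (\<lambda>n. ?w t n - ?w 0 n)"
    using picard_step_deriv(2)[OF F x] picard_step_deriv(2)[OF F y]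
    by (intro N_cong diff m[OF picard_step_continuous[OF F x x0]] m[OF picard_step_continuous[OF F y x0]]) simp
  ultimately show ?thesis using K by (simp add: D_def)
qed

text \<open>This puts the first increment into the weighted scale. The condition
  \<open>L \<ge> 1\<close> gives \<open>\<bar>t\<bar> \<le> 2 * L * \<bar>t\<bar>\<close>, which the
  exponential dominates.\<close>

lemma picard_step_base:
  assumes F: "lipschitz_map L F" and L: "L \<ge> 1" and x0: "x0 \<in> X"
  shows "D (picard_step F x0 (\<lambda>_. x0) t) x0 \<le> N (F x0) * exp (2 * L * \<bar>t\<bar>)"
proof -
  let ?w = "picard_step F x0 (\<lambda>_. x0)"
  note c = norm_continuous_on_const[OF x0, of UNIV]
  have Fx0: "F x0 \<in> X" using F x0 by (simp add: lipschitz_map_def)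
  have "N (\<lambda>n. ?w t n - ?w 0 n) \<le> N (F x0) * \<bar>t\<bar> - N (F x0) * 0"
  proof (rule mean_value(2)[where w' = "\<lambda>_. F x0" and \<phi>' = "\<lambda>_. N (F x0)"])
    show "((\<lambda>s. ?w s n) has_real_derivative F x0 n) (at s within closed_segment 0 t)"
      if "n \<in> A" for s n
      by (rule has_field_derivative_at_within) (rule picard_step_deriv(1)[OF F c that])
  qed (use Fx0 in \<open>auto intro!: derivative_eq_intros continuous_intros\<close>)
  moreover have "D (?w t) x0 = N (\<lambda>n. ?w t n - ?w 0 n)"
    unfolding D_def using picard_step_deriv(2)[OF F c]
    by (intro N_cong diff x0 norm_continuous_on_mem[OF picard_step_continuous[OF F c x0]]) auto
  moreover have "\<bar>t\<bar> \<le> exp (2 * L * \<bar>t\<bar>)"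
  proof -
    have "1 * \<bar>t\<bar> \<le> (2 * L) * \<bar>t\<bar>" using L by (intro mult_right_mono) auto
    then show ?thesis using exp_ge_add_one_self[of "2 * L * \<bar>t\<bar>"] by linarith
  qed
  then have "N (F x0) * \<bar>t\<bar> \<le> N (F x0) * exp (2 * L * \<bar>t\<bar>)"
    using N_nonneg[OF Fx0] by (intro mult_left_mono)
  ultimately show ?thesis by simp
qed

lemma lipschitz_global_solution:
  assumes F: "lipschitz_map L F" and L: "L \<ge> 1" and x0: "x0 \<in> X"
  shows "\<exists>x. solves F UNIV x \<and> (\<forall>n\<in>A. x 0 n = x0 n)"
proof -
  define xs where "xs k = (picard_step F x0 ^^ k) (\<lambda>_. x0)" for k
  define M where "M = N (F x0)"
  define E where "E t = exp (2 * L * \<bar>t\<bar>)" for t :: real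
  have E: "E t > 0" for t by (simp add: E_def)
  have M: "M \<ge> 0" using F x0 by (simp add: M_def lipschitz_map_def N_nonneg)
  have xs_Suc: "xs (Suc k) = picard_step F x0 (xs k)" for k by (simp add: xs_def)
  have c: "norm_continuous_on UNIV (xs k)" for k
    by (induction k) (simp_all add: xs_Suc picard_step_continuous[OF F _ x0],
        simp add: xs_def norm_continuous_on_const x0)
  have mem: "xs k t \<in> X" for k t using norm_continuous_on_mem[OF c] by simp
  have step: "D (xs (Suc k) t) (xs k t) \<le> M * (1/2) ^ k * E t" for k t
  proof (induction k arbitrary: t)
    case 0
    show ?case using picard_step_base[OF F L x0] by (simp add: xs_Suc) (simp add: xs_def M_def E_def)
  next
    case (Suc k)
    have "D (xs (Suc (Suc k)) t) (xs (Suc k) t) \<le> (M * (1/2) ^ k) / 2 * exp (2 * L * \<bar>t\<bar>)"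
      unfolding xs_Suc[of "Suc k"]
      by (subst (2) xs_Suc, rule picard_step_contract[OF F _ x0 c c])
         (use Suc L M in \<open>auto simp: E_def\<close>)
    then show ?case by (simp add: E_def)
  qed
  \<comment> \<open>The last factor makes the bound the exact partial sum of the geometric series,
    so that the induction closes; \<open>far'\<close> then discards it.\<close>
  have far: "D (xs (k + j) t) (xs k t) \<le> 2 * M * (1/2) ^ k * E t * (1 - (1/2) ^ j)" for k j t
  proof (induction j)
    case (Suc j)
    have "D (xs (k + Suc j) t) (xs k t) \<le> D (xs (Suc (k + j)) t) (xs (k + j) t) + D (xs (k + j) t) (xs k t)"
      using D_triangle[OF mem mem mem] by simp
    also have "\<dots> \<le> M * (1/2) ^ (k + j) * E t + 2 * M * (1/2) ^ k * E t * (1 - (1/2) ^ j)"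
      using step[of "k + j" t] Suc by simp
    also have "\<dots> = 2 * M * (1/2) ^ k * E t * (1 - (1/2) ^ Suc j)"
      by (simp add: power_add algebra_simps)
    finally show ?case .
  qed (simp add: D_self)
  have far': "D (xs (k + j) t) (xs k t) \<le> 2 * M * (1/2) ^ k * E t" for k j t
  proof -
    have "2 * M * (1/2) ^ k * E t * (1 - (1/2) ^ j) \<le> 2 * M * (1/2) ^ k * E t * 1"
      using M E[of t] by (intro mult_left_mono) auto
    then show ?thesis using far[of k j t] by simp
  qed
  have small: "(\<lambda>k. C * M * (1/2) ^ k * E t) \<longlonglongrightarrow> 0" for t C
    using tendsto_mult_left[OF LIMSEQ_power_zero[of "1/2 :: real"], of "C * M * E t"]
    by (simp add: algebra_simps)
  have "convergent (\<lambda>k. xs k t n)" if n: "n \<in> A" for t n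
  proof (intro Cauchy_convergent CauchyI')
    fix e :: real assume "e > 0"
    then have "\<forall>\<^sub>F k in sequentially. 2 * M * (1/2) ^ k * E t < e"
      by (intro order_tendstoD(2)[OF small])
    then obtain k0 where k0: "\<And>k. k \<ge> k0 \<Longrightarrow> 2 * M * (1/2) ^ k * E t < e"
      by (auto simp: eventually_sequentially)
    have "dist (xs m t n) (xs k t n) < e" if "m \<ge> k0" "k > m" for m k
    proof -
      have "\<bar>xs k t n - xs m t n\<bar> \<le> D (xs k t) (xs m t)" using D_pointwise[OF mem mem n] .
      also have "\<dots> \<le> 2 * M * (1/2) ^ m * E t" using far'[of m "k - m" t] that by simp
      also have "\<dots> < e" using k0 that by simp
      finally show ?thesis by (simp add: dist_real_def abs_minus_commute)
    qed
    then show "\<exists>m0. \<forall>m\<ge>m0. \<forall>k>m. dist (xs m t n) (xs k t n) < e" by blast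
  qed
  then have "\<exists>x. \<forall>t. \<forall>n\<in>A. (\<lambda>k. xs k t n) \<longlonglongrightarrow> x t n"
    by (intro exI[of _ "\<lambda>t n. lim (\<lambda>k. xs k t n)"]) (auto simp: convergent_LIMSEQ_iff)
  then obtain x where x: "\<And>t n. n \<in> A \<Longrightarrow> (\<lambda>k. xs k t n) \<longlonglongrightarrow> x t n" by blast
  \<comment> \<open>The limit is known only at each site. Letting \<open>j\<close> tend to infinity
    in \<open>far'\<close> through \<open>fatou\<close> yields membership and the rate of
    convergence together.\<close>
  have lim: "(\<lambda>n. x t n - xs k t n) \<in> X \<and> N (\<lambda>n. x t n - xs k t n) \<le> 2 * M * (1/2) ^ k * E t" for k t
  proof (rule fatou)
    show "(\<lambda>n. xs (k + j) t n - xs k t n) \<in> X" for j by (intro diff mem)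
    show "N (\<lambda>n. xs (k + j) t n - xs k t n) \<le> 2 * M * (1/2) ^ k * E t" for j
      using far' by (simp add: D_def)
    show "(\<lambda>j. xs (k + j) t n - xs k t n) \<longlonglongrightarrow> x t n - xs k t n" if "n \<in> A" for n
      using LIMSEQ_ignore_initial_segment[OF x[OF that, of t], of k] by (intro tendsto_intros) (simp add: add.commute)
  qed
  have xmem: "x t \<in> X" for t
    using add[OF conjunct1[OF lim[of t 0]] mem[of 0 t]] by simp
  have xD: "D (x t) (xs k t) \<le> 2 * M * (1/2) ^ k * E t" for t k
    using lim by (simp add: D_def)
  have xc: "norm_continuous_on UNIV x"
    unfolding norm_continuous_on_def
  proof (intro conjI ballI xmem tendstoI)
    fix t e :: real assume "e > 0"
    then have "\<forall>\<^sub>F k in sequentially. 2 * M * (1/2) ^ k * E (\<bar>t\<bar> + 1) < e / 3"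
      by (intro order_tendstoD(2)[OF small]) simp
    then obtain k where k: "2 * M * (1/2) ^ k * E (\<bar>t\<bar> + 1) < e / 3"
      by (auto simp: eventually_sequentially)
    \<comment> \<open>The weight is monotone in \<open>\<bar>s\<bar>\<close>, so a single iterate
      \<open>k\<close> approximates \<open>x\<close> on a whole neighbourhood of \<open>t\<close>,
      as the three-term estimate requires.\<close>
    have near: "D (x s) (xs k s) < e / 3" if "\<bar>s\<bar> \<le> \<bar>t\<bar> + 1" for s
    proof -
      have "E s \<le> E (\<bar>t\<bar> + 1)" using that L by (simp add: E_def)
      then have "2 * M * (1/2) ^ k * E s \<le> 2 * M * (1/2) ^ k * E (\<bar>t\<bar> + 1)"
        using M by (intro mult_left_mono) auto
      then show ?thesis using xD[of s k] k by linarith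
    qed
    have "((\<lambda>s. D (xs k s) (xs k t)) \<longlongrightarrow> 0) (at t)" using c[of k] by (auto simp: norm_continuous_on_def)
    then have "\<forall>\<^sub>F s in at t. D (xs k s) (xs k t) < e / 3" using \<open>e > 0\<close> by (intro order_tendstoD) auto
    moreover have "\<forall>\<^sub>F s in at t. dist s t < 1"
      using eventually_at by (metis zero_less_one)
    ultimately show "\<forall>\<^sub>F s in at t. dist (D (x s) (x t)) 0 < e"
    proof eventually_elim
      case (elim s)
      have "D (x s) (x t) \<le> D (x s) (xs k s) + (D (xs k s) (xs k t) + D (xs k t) (x t))"
        using D_triangle[OF xmem[of s] mem[of k s] xmem[of t]]
          D_triangle[OF mem[of k s] mem[of k t] xmem[of t]] by linarith
      moreover have "D (x s) (xs k s) < e / 3" using elim by (intro near) (auto simp: dist_real_def)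
      moreover have "D (xs k t) (x t) < e / 3" using near[of t] D_sym[OF mem xmem] by simp
      ultimately show ?case using elim D_nonneg[OF xmem xmem] by simp
    qed
  qed
  \<comment> \<open>Both sides lie within \<open>M * (1/2) ^ k * E t\<close> of the iterate
    \<open>xs (Suc k) t\<close>, for every \<open>k\<close>.\<close>
  have eq: "x t n = picard_step F x0 x t n" if n: "n \<in> A" for t n
  proof (rule eq_if_D_le_0[OF xmem _ _ n])
    show y: "picard_step F x0 x t \<in> X"
      using norm_continuous_on_mem[OF picard_step_continuous[OF F xc x0]] by simp
    have "D (x t) (picard_step F x0 x t) \<le> 2 * M * (1/2) ^ k * E t" for k
    proof -
      have "D (picard_step F x0 x t) (picard_step F x0 (xs k) t)
          \<le> (2 * M * (1/2) ^ k) / 2 * exp (2 * L * \<bar>t\<bar>)"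
        by (rule picard_step_contract[OF F _ x0 xc c]) (use xD M L in \<open>auto simp: E_def\<close>)
      then have "D (picard_step F x0 x t) (xs (Suc k) t) \<le> M * (1/2) ^ k * E t"
        by (simp add: xs_Suc E_def)
      moreover have "D (x t) (xs (Suc k) t) \<le> M * (1/2) ^ k * E t" using xD[of t "Suc k"] by simp
      ultimately show ?thesis
        using D_triangle[OF xmem[of t] mem[of "Suc k" t] y] D_sym[OF mem[of "Suc k" t] y] by linarith
    qed
    then show "D (x t) (picard_step F x0 x t) \<le> 0" by (intro LIMSEQ_le_const[OF small]) auto
  qed
  have "solves F UNIV x"
    unfolding solves_def
  proof (intro conjI ballI xc)
    fix t n assume n: "n \<in> A"
    then show "((\<lambda>s. x s n) has_real_derivative F (x t) n) (at t)"
      using picard_step_deriv(1)[OF F xc n, of x0 t] by (simp add: eq[OF n, symmetric])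
  qed
  moreover have "\<forall>n\<in>A. x 0 n = x0 n" using eq picard_step_deriv(2)[OF F xc] by metis
  ultimately show ?thesis by blast
qed

end

section \<open>Maximal solutions for locally Lipschitz fields\<close>

context fun_norm
begin

text \<open>Lipschitz on every ball, which in infinite dimension is more than having a Lipschitz
  constant near each point; truncation needs one constant for the entire ball.\<close>

definition locally_lipschitz :: "(('a \<Rightarrow> real) \<Rightarrow> 'a \<Rightarrow> real) \<Rightarrow> bool" where
  "locally_lipschitz F \<longleftrightarrow> (\<forall>x\<in>X. F x \<in> X) \<and>
     (\<forall>R. \<exists>L. \<forall>x\<in>X. \<forall>y\<in>X. N x \<le> R \<longrightarrow> N y \<le> R \<longrightarrow> D (F x) (F y) \<le> L * D x y)"

section \<open>The radial retraction and truncated fields\<close>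

definition truncate :: "real \<Rightarrow> ('a \<Rightarrow> real) \<Rightarrow> 'a \<Rightarrow> real" where
  "truncate R x = (if N x \<le> R then x else (\<lambda>n. R / N x * x n))"

lemma truncate_mem: "x \<in> X \<Longrightarrow> truncate R x \<in> X"
  unfolding truncate_def using scale[of x "R / N x"] by auto

lemma N_truncate: "x \<in> X \<Longrightarrow> R > 0 \<Longrightarrow> N (truncate R x) \<le> R"
  using N_scale[of x "R / N x"] by (auto simp: truncate_def)

text \<open>If only \<open>x\<close> lies outside the ball, retraction moves it by
  \<open>N x - R\<close>, at most \<open>D x y\<close>. If both lie outside, scaling by the common
  factor \<open>R / N x \<le> 1\<close> costs \<open>D x y\<close>, and the difference of the two
  factors costs \<open>\<bar>N x - N y\<bar>\<close>. The constant 2 obtained this way is valid for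
  any norm; no inner product is involved.\<close>

lemma D_truncate:
  assumes x: "x \<in> X" and y: "y \<in> X" and R: "R > 0"
  shows "D (truncate R x) (truncate R y) \<le> 2 * D x y"
proof -
  have one: "D (truncate R x) y \<le> 2 * D x y"
    if x: "x \<in> X" and y: "y \<in> X" and Nx: "N x > R" and Ny: "N y \<le> R" for x y
  proof -
    have "D (truncate R x) x = N (\<lambda>n. (R / N x - 1) * x n)"
      using Nx by (simp add: D_def truncate_def algebra_simps)
    also have "\<dots> = \<bar>R / N x - 1\<bar> * N x" by (rule N_scale[OF x])
    also have "\<dots> = N x - R" using Nx R by (simp add: abs_if field_simps)
    also have "\<dots> \<le> D x y" using N_le_D[OF x y] Ny by simp
    finally show ?thesis using D_triangle[OF truncate_mem[OF x] x y, of R] by simp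
  qed
  have D0: "0 \<le> D x y" using x y by (rule D_nonneg)
  consider "N x \<le> R" "N y \<le> R" | "N x > R" "N y \<le> R" | "N x \<le> R" "N y > R" | "N x > R" "N y > R"
    by linarith
  then show ?thesis
  proof cases
    case 1
    then show ?thesis using D0 by (simp add: truncate_def)
  next
    case 2
    then show ?thesis using one[OF x y] by (simp add: truncate_def)
  next
    case 3
    then have "truncate R x = x" by (simp add: truncate_def)
    with 3 show ?thesis using one[OF y x] D_sym[OF x y] D_sym[OF x truncate_mem[OF y], of R] by simp
  next
    case 4
    let ?a = "\<lambda>n. R / N x * (x n - y n)" and ?b = "\<lambda>n. (R / N x - R / N y) * y n"
    have "(\<lambda>n. truncate R x n - truncate R y n) = (\<lambda>n. ?a n + ?b n)"
      using 4 by (simp add: truncate_def algebra_simps)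
    then have "D (truncate R x) (truncate R y) \<le> N ?a + N ?b"
      using N_add[OF scale[OF diff[OF x y]] scale[OF y]] by (simp only: D_def)
    also have "N ?a = R / N x * D x y"
      using N_scale[OF diff[OF x y], of "R / N x"] 4 R by (simp add: D_def)
    also have "\<dots> \<le> 1 * D x y"
      using 4 R D0 by (intro mult_right_mono) (auto simp: divide_le_eq)
    also have "N ?b = R / N x * \<bar>N x - N y\<bar>"
    proof -
      have "R / N x - R / N y = R / N x * (N y - N x) / N y" using 4 R by (simp add: field_simps)
      then have "\<bar>R / N x - R / N y\<bar> = R / N x * \<bar>N x - N y\<bar> / N y"
        using 4 R by (simp add: abs_mult abs_minus_commute)
      then show ?thesis using N_scale[OF y] 4 R by simp
    qed
    also have "\<dots> \<le> 1 * \<bar>N x - N y\<bar>"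
      using 4 R by (intro mult_right_mono) (auto simp: divide_le_eq)
    finally show ?thesis using N_diff_le_D[OF x y] by simp
  qed
qed

lemma lipschitz_truncate:
  assumes F: "locally_lipschitz F" and R: "R > 0"
  obtains L where "L \<ge> 1" "lipschitz_map L (\<lambda>x. F (truncate R x))"
proof -
  obtain L where L: "\<And>x y. x \<in> X \<Longrightarrow> y \<in> X \<Longrightarrow> N x \<le> R \<Longrightarrow> N y \<le> R \<Longrightarrow> D (F x) (F y) \<le> L * D x y"
    using F unfolding locally_lipschitz_def by meson
  \<comment> \<open>The 2 comes from the retraction; the maximum makes the constant nonnegative and
    at least 1, as the global existence result demands.\<close>
  define L' where "L' = 2 * max L 1"
  have "D (F (truncate R x)) (F (truncate R y)) \<le> L' * D x y" if x: "x \<in> X" and y: "y \<in> X" for x y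
  proof -
    note mem = truncate_mem[OF x, of R] truncate_mem[OF y, of R]
    have "D (F (truncate R x)) (F (truncate R y)) \<le> L * D (truncate R x) (truncate R y)"
      using L mem N_truncate R x y by blast
    also have "\<dots> \<le> max L 1 * D (truncate R x) (truncate R y)"
      using D_nonneg[OF mem] by (intro mult_right_mono) auto
    also have "\<dots> \<le> max L 1 * (2 * D x y)"
      using D_truncate[OF x y R] by (intro mult_left_mono) auto
    finally show ?thesis by (simp add: L'_def)
  qed
  then have "lipschitz_map L' (\<lambda>x. F (truncate R x))"
    using F truncate_mem by (auto simp: lipschitz_map_def locally_lipschitz_def)
  then show thesis using that[of L'] by (simp add: L'_def)
qed

lemma solves_truncate_iff:
  assumes "\<And>t. t \<in> J \<Longrightarrow> N (x t) \<le> R"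
  shows "solves (\<lambda>x. F (truncate R x)) J x \<longleftrightarrow> solves F J x"
  unfolding solves_def using assms by (simp add: truncate_def)

section \<open>Uniqueness for the untruncated equation\<close>

lemma segment_subset_interval:
  fixes t :: real
  assumes "is_interval J" "0 \<in> J" "t \<in> J"
  shows "closed_segment 0 t \<subseteq> J"
  using assms by (meson closed_segment_subset is_interval_convex_1)

lemma norm_continuous_on_segment_bounded:
  assumes "norm_continuous_on (closed_segment 0 t) x"
  obtains R where "R > 0" "\<And>s. s \<in> closed_segment 0 t \<Longrightarrow> N (x s) < R"
proof -
  obtain a b where ab: "closed_segment 0 t = {a..b}" by (metis closed_segment_eq_real_ivl)
  obtain C where C: "C \<ge> 0" "\<forall>t\<in>{a..b}. N (x t) \<le> C"
    using norm_continuous_on_bounded assms ab by metis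
  show thesis by (rule that[of "C + 1"]) (use C ab in force)+
qed

text \<open>On the compact segment from 0 to \<open>t\<close> both curves are bounded, so they stay
  in a common ball and solve the same truncated equation. Stability with initial distance 0 applies
  there, and no interval larger than this segment matters.\<close>

lemma solution_unique:
  assumes F: "locally_lipschitz F" and x: "solves F J x" and y: "solves F J y"
    and J: "is_interval J" "0 \<in> J" and init: "\<And>n. n \<in> A \<Longrightarrow> x 0 n = y 0 n"
    and t: "t \<in> J" and n: "n \<in> A"
  shows "x t n = y t n"
proof -
  let ?S = "closed_segment 0 t"
  have xS: "solves F ?S x" and yS: "solves F ?S y"
    using x y segment_subset_interval[OF J t] solves_subset by blast+
  obtain R1 where R1: "R1 > 0" "\<And>s. s \<in> ?S \<Longrightarrow> N (x s) < R1"
    using norm_continuous_on_segment_bounded xS unfolding solves_def by metis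
  obtain R2 where R2: "R2 > 0" "\<And>s. s \<in> ?S \<Longrightarrow> N (y s) < R2"
    using norm_continuous_on_segment_bounded yS unfolding solves_def by metis
  define R where "R = max R1 R2"
  have R: "R > 0" using R1(1) by (simp add: R_def)
  obtain L where L: "L \<ge> 1" "lipschitz_map L (\<lambda>x. F (truncate R x))"
    using lipschitz_truncate[OF F R] .
  have x': "solves (\<lambda>x. F (truncate R x)) ?S x"
    by (rule solves_truncate_iff[THEN iffD2, OF _ xS]) (use R1(2) in \<open>force simp: R_def\<close>)
  have y': "solves (\<lambda>x. F (truncate R x)) ?S y"
    by (rule solves_truncate_iff[THEN iffD2, OF _ yS]) (use R2(2) in \<open>force simp: R_def\<close>)
  have mem: "x s \<in> X" "y s \<in> X" if "s \<in> J" for s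
    using x y that norm_continuous_on_mem by (auto simp: solves_def)
  have S: "is_interval ?S" "0 \<in> ?S" "t \<in> ?S" by (auto simp: is_interval_convex_1)
  have "D (x t) (y t) \<le> 2 * D (x 0) (y 0) * exp (2 * L * \<bar>t\<bar>)"
    using L(1) by (intro lipschitz_stability[OF L(2) _ x' y' S]) simp
  also have "D (x 0) (y 0) = 0"
    unfolding D_def using N_cong[OF diff[OF mem[OF J(2)]], of "\<lambda>_. 0"] init N_zero by simp
  finally show ?thesis using eq_if_D_le_0[OF mem[OF t] _ n] by simp
qed

section \<open>Maximal solutions and continuous dependence\<close>

definition truncated_flow :: "(('a \<Rightarrow> real) \<Rightarrow> 'a \<Rightarrow> real) \<Rightarrow> ('a \<Rightarrow> real) \<Rightarrow> real \<Rightarrow> real \<Rightarrow> 'a \<Rightarrow> real" where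
  "truncated_flow F x0 R = (SOME y. solves (\<lambda>x. F (truncate R x)) UNIV y \<and> (\<forall>n\<in>A. y 0 n = x0 n))"

lemma truncated_flow:
  assumes F: "locally_lipschitz F" and R: "R > 0" and x0: "x0 \<in> X"
  shows "solves (\<lambda>x. F (truncate R x)) UNIV (truncated_flow F x0 R)"
    and "n \<in> A \<Longrightarrow> truncated_flow F x0 R 0 n = x0 n"
proof -
  obtain L where "L \<ge> 1" "lipschitz_map L (\<lambda>x. F (truncate R x))"
    using lipschitz_truncate[OF F R] .
  from someI_ex[OF lipschitz_global_solution[OF this(2,1) x0]]
  show "solves (\<lambda>x. F (truncate R x)) UNIV (truncated_flow F x0 R)"
    and "n \<in> A \<Longrightarrow> truncated_flow F x0 R 0 n = x0 n"
    by (auto simp: truncated_flow_def)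
qed

lemma maximal_solution_exists:
  assumes F: "locally_lipschitz F" and x0: "x0 \<in> X"
  shows "\<exists>I x. open I \<and> is_interval I \<and> 0 \<in> I \<and> solves F I x \<and> (\<forall>n\<in>A. x 0 n = x0 n) \<and>
    (\<forall>J y. is_interval J \<and> 0 \<in> J \<and> solves F J y \<and> (\<forall>n\<in>A. y 0 n = x0 n) \<longrightarrow> J \<subseteq> I)"
proof -
  define \<Phi> where "\<Phi> = truncated_flow F x0"
  \<comment> \<open>The strict inequality makes this condition open in \<open>t\<close>; asking for
    it on the whole segment passes it on to all times closer to 0, so that \<open>I\<close> becomes
    an interval.\<close>
  define good where "good R t \<longleftrightarrow> R > 0 \<and> (\<forall>s\<in>closed_segment 0 t. N (\<Phi> R s) < R)" for R t
  define I where "I = {t. \<exists>R. good R t}"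
  \<comment> \<open>The radius is chosen anew at each time, so regularity of \<open>x\<close> is not
    immediate. By \<open>good_eq\<close> the choice does not affect the values on \<open>A\<close>,
    and near each time a single flow can be used.\<close>
  define x where "x t = \<Phi> (SOME R. good R t) t" for t
  note flow = truncated_flow[OF F _ x0, folded \<Phi>_def]
  have seg: "is_interval (closed_segment 0 t)" "0 \<in> closed_segment 0 t" "t \<in> closed_segment 0 t" for t :: real
    by (auto simp: is_interval_convex_1)
  have good_solves: "solves F (closed_segment 0 t) (\<Phi> R)" if "good R t" for R t
    by (rule solves_truncate_iff[THEN iffD1, OF _ solves_subset[OF flow(1)]])
       (use that in \<open>auto simp: good_def less_imp_le\<close>)
  have good_sub: "good R s" if "good R t" "s \<in> closed_segment 0 t" for R s t
    using that subset_closed_segment[of 0 s 0 t] by (auto simp: good_def)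
  have good_eq: "x t n = \<Phi> R t n" if g: "good R t" and n: "n \<in> A" for R t n
  proof -
    define R' where "R' = (SOME R. good R t)"
    have g': "good R' t" unfolding R'_def using g by (rule someI)
    have "\<Phi> R' 0 n = \<Phi> R 0 n" if "n \<in> A" for n
      using flow(2)[OF _ that] g g' by (simp add: good_def)
    then show ?thesis
      using solution_unique[OF F good_solves[OF g'] good_solves[OF g] seg(1,2) _ seg(3) n]
      by (simp add: x_def R'_def)
  qed
  have good_nhd: "\<exists>d>0. \<forall>s. dist s t < d \<longrightarrow> good R s" if g: "good R t" for R t
  proof -
    have "norm_continuous_on UNIV (\<Phi> R)" using flow(1) g by (simp add: good_def solves_def)
    then have "isCont (\<lambda>s. N (\<Phi> R s)) t"
      using continuous_on_N continuous_on_eq_continuous_at by blast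
    then have "((\<lambda>s. N (\<Phi> R s)) \<longlongrightarrow> N (\<Phi> R t)) (nhds t)"
      unfolding isCont_def by (rule tendsto_at_iff_tendsto_nhds[THEN iffD1])
    moreover have "N (\<Phi> R t) < R" using g by (simp add: good_def)
    ultimately have "\<forall>\<^sub>F s in nhds t. N (\<Phi> R s) < R"
      by (rule order_tendstoD(2))
    then obtain d where d: "d > 0" "\<And>s. dist s t < d \<Longrightarrow> N (\<Phi> R s) < R"
      by (auto simp: eventually_nhds_metric)
    have "good R s" if "dist s t < d" for s
      unfolding good_def
    proof (intro conjI ballI)
      show "R > 0" using g by (simp add: good_def)
      \<comment> \<open>A point between 0 and \<open>s\<close> is either between 0 and
        \<open>t\<close>, or between \<open>t\<close> and \<open>s\<close>.\<close>
      fix r assume "r \<in> closed_segment 0 s"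
      then have "r \<in> closed_segment 0 t \<or> dist r t < d"
        using that by (auto simp: closed_segment_eq_real_ivl dist_real_def split: if_splits)
      then show "N (\<Phi> R r) < R" using g d(2) by (auto simp: good_def)
    qed
    then show ?thesis using d(1) by blast
  qed
  \<comment> \<open>A competitor is strictly bounded by some \<open>R\<close> on the segment to
    \<open>t\<close>, so it solves the equation truncated at \<open>R\<close> and is at distance 0
    from \<open>\<Phi> R\<close>. The flow inherits the strict bound, which makes \<open>t\<close>
    good.\<close>
  have maximal: "J \<subseteq> I" if J: "is_interval J" "0 \<in> J" and y: "solves F J y"
    and init: "\<And>n. n \<in> A \<Longrightarrow> y 0 n = x0 n" for J y
  proof
    fix t assume t: "t \<in> J"
    let ?S = "closed_segment 0 t"
    have yS: "solves F ?S y" using y segment_subset_interval[OF J t] solves_subset by blast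
    obtain R where R: "R > 0" "\<And>s. s \<in> ?S \<Longrightarrow> N (y s) < R"
      using norm_continuous_on_segment_bounded yS unfolding solves_def by metis
    obtain L where L: "L \<ge> 1" "lipschitz_map L (\<lambda>x. F (truncate R x))"
      using lipschitz_truncate[OF F R(1)] .
    have yR: "solves (\<lambda>x. F (truncate R x)) ?S y"
      by (rule solves_truncate_iff[THEN iffD2, OF _ yS]) (use R(2) in \<open>auto simp: less_imp_le\<close>)
    have fR: "solves (\<lambda>x. F (truncate R x)) ?S (\<Phi> R)"
      using flow(1)[OF R(1)] solves_subset by blast
    have mem: "y s \<in> X" "\<Phi> R s \<in> X" if "s \<in> ?S" for s
      using yS fR that norm_continuous_on_mem by (auto simp: solves_def)
    have "N (\<Phi> R s) < R" if s: "s \<in> ?S" for s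
    proof -
      have "D (\<Phi> R s) (y s) \<le> 2 * D (\<Phi> R 0) (y 0) * exp (2 * L * \<bar>s\<bar>)"
        using L(1) by (intro lipschitz_stability[OF L(2) _ fR yR seg(1,2) s]) simp
      also have "D (\<Phi> R 0) (y 0) = 0"
        unfolding D_def
        using N_cong[OF diff[OF mem(2,1)[OF seg(2)]], of "\<lambda>_. 0"] init flow(2)[OF R(1)] N_zero by simp
      finally show ?thesis using N_le_D[OF mem(2,1)[OF s]] R(2)[OF s] by simp
    qed
    then show "t \<in> I" using R(1) by (auto simp: I_def good_def)
  qed
  have "open I"
    unfolding open_dist I_def using good_nhd by blast
  have "good (N x0 + 1) 0"
  proof -
    have p: "N x0 + 1 > 0" using N_nonneg[OF x0] by simp
    have "\<Phi> (N x0 + 1) 0 \<in> X"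
      using flow(1)[OF p] norm_continuous_on_mem by (auto simp: solves_def)
    then have "N (\<Phi> (N x0 + 1) 0) = N x0" using N_cong flow(2)[OF p] by blast
    then show ?thesis using p by (simp add: good_def)
  qed
  then have "0 \<in> I" by (auto simp: I_def)
  have "is_interval I"
    unfolding is_interval_1
  proof (intro ballI allI impI)
    fix a b t assume ab: "a \<in> I" "b \<in> I" and t: "a \<le> t \<and> t \<le> b"
    then have "t \<in> closed_segment 0 a \<or> t \<in> closed_segment 0 b"
      by (auto simp: closed_segment_eq_real_ivl)
    then show "t \<in> I" using ab good_sub by (auto simp: I_def)
  qed
  have "solves F I x"
    unfolding solves_def norm_continuous_on_def
  proof (intro conjI ballI)
    fix t assume "t \<in> I"
    then obtain R where g: "good R t" by (auto simp: I_def)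
    then have R: "R > 0" by (simp add: good_def)
    obtain d where d: "d > 0" "\<And>s. dist s t < d \<Longrightarrow> good R s" using good_nhd[OF g] by blast
    have eq: "x s n = \<Phi> R s n" if "dist s t < d" "n \<in> A" for s n
      using good_eq d(2) that by blast
    have c: "norm_continuous_on UNIV (\<Phi> R)" using flow(1)[OF R] by (simp add: solves_def)
    have fmem: "\<Phi> R s \<in> X" for s using norm_continuous_on_mem[OF c] by simp
    have xmem: "x s \<in> X" if "dist s t < d" for s
      by (rule mem_cong[OF fmem[of s]]) (simp add: eq that)
    show "x t \<in> X" using xmem d(1) by simp
    have near: "\<forall>\<^sub>F s in at t within I. dist s t < d"
      using d(1) by (auto simp: eventually_at)
    have "((\<lambda>s. D (\<Phi> R s) (\<Phi> R t)) \<longlongrightarrow> 0) (at t within I)"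
      using norm_continuous_on_subset[OF c, of I] \<open>t \<in> I\<close> by (simp add: norm_continuous_on_def)
    moreover have "\<forall>\<^sub>F s in at t within I. D (\<Phi> R s) (\<Phi> R t) = D (x s) (x t)"
      using near by eventually_elim
        (use eq d(1) in \<open>auto simp: D_def intro!: N_cong diff fmem\<close>)
    ultimately show "((\<lambda>s. D (x s) (x t)) \<longlongrightarrow> 0) (at t within I)"
      by (rule Lim_transform_eventually)
    fix n assume n: "n \<in> A"
    have Nt: "N (\<Phi> R t) \<le> R" using g by (auto simp: good_def less_imp_le)
    have "((\<lambda>s. \<Phi> R s n) has_real_derivative F (truncate R (\<Phi> R t)) n) (at t within I)"
      using solves_subset[OF flow(1)[OF R], of I] \<open>t \<in> I\<close> n by (simp add: solves_def)
    then have "((\<lambda>s. \<Phi> R s n) has_real_derivative F (\<Phi> R t) n) (at t within I)"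
      using Nt by (simp add: truncate_def)
    \<comment> \<open>The two arguments agree only on \<open>A\<close>, and \<open>F\<close> could a
      priori look elsewhere. The Lipschitz estimate at distance 0 excludes this.\<close>
    moreover have "F (\<Phi> R t) n = F (x t) n"
    proof -
      obtain L where L: "D (F (\<Phi> R t)) (F (x t)) \<le> L * D (\<Phi> R t) (x t)"
        using F fmem[of t] xmem[of t] d(1) unfolding locally_lipschitz_def
        by (metis dist_self linorder_le_cases max.cobounded1 max.cobounded2)
      have "D (\<Phi> R t) (x t) = 0"
        unfolding D_def using N_cong[OF diff[OF fmem[of t] xmem[of t]], of "\<lambda>_. 0"] eq[of t] d(1) N_zero by simp
      with L show ?thesis
        using F fmem[of t] xmem[of t] d(1) n by (intro eq_if_D_le_0) (auto simp: locally_lipschitz_def)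
    qed
    ultimately have "((\<lambda>s. \<Phi> R s n) has_real_derivative F (x t) n) (at t within I)" by simp
    then show "((\<lambda>s. x s n) has_real_derivative F (x t) n) (at t within I)"
      by (rule has_field_derivative_transform_within[OF _ d(1) \<open>t \<in> I\<close>]) (simp add: eq n)
  qed
  moreover have "x 0 n = x0 n" if "n \<in> A" for n
    using good_eq[OF \<open>good (N x0 + 1) 0\<close> that] flow(2)[OF _ that] \<open>good (N x0 + 1) 0\<close> by (simp add: good_def)
  moreover have "\<forall>J y. is_interval J \<and> 0 \<in> J \<and> solves F J y \<and> (\<forall>n\<in>A. y 0 n = x0 n) \<longrightarrow> J \<subseteq> I"
    by (intro allI impI, elim conjE, rule maximal, assumption+) simp
  ultimately show ?thesis
    using \<open>open I\<close> \<open>is_interval I\<close> \<open>0 \<in> I\<close> by (intro exI[of _ I] exI[of _ x] conjI ballI) simp_all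
qed

text \<open>Existence of the perturbed solution on all of \<open>{a..b}\<close> is part of the
  conclusion. It needs no continuation argument: the truncated flow is global, and once Gronwall
  confines it to the ball it solves the original equation.\<close>

lemma continuous_dependence_on_initial_value:
  assumes F: "locally_lipschitz F" and x: "solves F {a..b} x" and ab: "a \<le> 0" "0 \<le> b" and e: "e > 0"
  shows "\<exists>d>0. \<forall>y0\<in>X. D y0 (x 0) < d \<longrightarrow>
    (\<exists>y. solves F {a..b} y \<and> (\<forall>n\<in>A. y 0 n = y0 n) \<and> (\<forall>t\<in>{a..b}. D (y t) (x t) < e))"
proof -
  have xc: "norm_continuous_on {a..b} x" using x by (simp add: solves_def)
  obtain C where C: "C \<ge> 0" "\<And>t. t \<in> {a..b} \<Longrightarrow> N (x t) \<le> C"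
    using norm_continuous_on_bounded[OF xc] by blast
  \<comment> \<open>The margin 1 is the room for perturbed flows: distance below
    \<open>min e 1\<close> from \<open>x\<close> keeps them in the ball of radius
    \<open>R\<close>.\<close>
  define R where "R = C + 1"
  have R: "R > 0" using C by (simp add: R_def)
  obtain L where L: "L \<ge> 1" "lipschitz_map L (\<lambda>x. F (truncate R x))"
    using lipschitz_truncate[OF F R] .
  have xR: "solves (\<lambda>x. F (truncate R x)) {a..b} x"
    by (rule solves_truncate_iff[THEN iffD2, OF _ x]) (use C(2) in \<open>force simp: R_def\<close>)
  \<comment> \<open>The stability factor at the time in \<open>{a..b}\<close> farthest from 0;
    dividing \<open>min e 1\<close> by it gives the admissible initial distance.\<close>
  define K where "K = 2 * exp (2 * L * max (- a) b)"
  have K: "K > 0" by (simp add: K_def)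
  have zero_in: "0 \<in> {a..b}" using ab by simp
  have "\<exists>y. solves F {a..b} y \<and> (\<forall>n\<in>A. y 0 n = y0 n) \<and> (\<forall>t\<in>{a..b}. D (y t) (x t) < e)"
    if y0: "y0 \<in> X" and close: "D y0 (x 0) < min e 1 / K" for y0
  proof -
    let ?y = "truncated_flow F y0 R"
    note y = truncated_flow[OF F R y0]
    have yR: "solves (\<lambda>x. F (truncate R x)) {a..b} ?y" using y(1) solves_subset by blast
    have mem: "x t \<in> X" "?y t \<in> X" if "t \<in> {a..b}" for t
      using xR yR that norm_continuous_on_mem by (auto simp: solves_def)
    have "D (?y 0) (x 0) = D y0 (x 0)"
      unfolding D_def using y(2) mem[OF zero_in] by (intro N_cong diff) auto
    then have close': "K * D (?y 0) (x 0) < min e 1" using close K by (simp add: field_simps)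
    have D: "D (?y t) (x t) < min e 1" if t: "t \<in> {a..b}" for t
    proof -
      have "D (?y t) (x t) \<le> 2 * D (?y 0) (x 0) * exp (2 * L * \<bar>t\<bar>)"
        using L(1) by (intro lipschitz_stability[OF L(2) _ yR xR _ zero_in t]) (auto simp: is_interval_convex_1)
      also have "\<dots> \<le> 2 * D (?y 0) (x 0) * exp (2 * L * max (- a) b)"
        using L(1) t D_nonneg[OF mem(2,1)[OF zero_in]] by (intro mult_left_mono) auto
      also have "\<dots> = K * D (?y 0) (x 0)" by (simp add: K_def)
      finally show ?thesis using close' by linarith
    qed
    have "N (?y t) \<le> R" if t: "t \<in> {a..b}" for t
      using N_le_D[OF mem(2,1)[OF t]] D[OF t] C(2)[OF t] by (simp add: R_def)
    then have "solves F {a..b} ?y" using solves_truncate_iff[THEN iffD1, OF _ yR] by blast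
    then show ?thesis using y(2) D by (intro exI[of _ ?y]) auto
  qed
  then show ?thesis using e K by (intro exI[of _ "min e 1 / K"]) auto
qed

end

section \<open>The sequence spaces and their products\<close>

lemma powr_convex_nonneg:
  fixes r s t x y :: real
  assumes r: "r \<ge> 1" and st: "s > 0" "t > 0" "s + t = 1" and xy: "x \<ge> 0" "y \<ge> 0"
  shows "(s * x + t * y) powr r \<le> s * x powr r + t * y powr r"
proof -
  \<comment> \<open>If \<open>x\<close> or \<open>y\<close> vanishes, the claim reduces to this
    inequality for the remaining weight.\<close>
  have le1: "a powr r \<le> a" if "0 < a" "a \<le> 1" for a :: real
    using powr_mono'[OF r, of a] that by simp
  consider "x = 0" | "y = 0" | "x > 0" "y > 0" using xy by linarith
  then show ?thesis
  proof cases
    case 1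
    have "t powr r * y powr r \<le> t * y powr r" using le1[of t] st by (intro mult_right_mono) auto
    with 1 show ?thesis using st xy by (simp add: powr_mult)
  next
    case 2
    have "s powr r * x powr r \<le> s * x powr r" using le1[of s] st by (intro mult_right_mono) auto
    with 2 show ?thesis using st xy by (simp add: powr_mult)
  next
    case 3
    have s: "1 - t = s" using st by simp
    show ?thesis using convex_onD[OF powr_convex[OF r], of t x y, simplified, unfolded s] st 3 by simp
  qed
qed

text \<open>Convexity of the power is applied to \<open>\<bar>u n\<bar> / a\<close> and
  \<open>\<bar>w n\<bar> / b\<close> with weights \<open>a / (a + b)\<close> and
  \<open>b / (a + b)\<close>, so no conjugate exponent appears. Bounds \<open>a\<close> and
  \<open>b\<close> in place of norms make the inequality usable before any infinite sum is known to
  converge.\<close>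

lemma Minkowski_finite_sum:
  fixes u w :: "'a \<Rightarrow> real"
  assumes r: "r \<ge> 1" and F: "finite F" and ab: "a \<ge> 0" "b \<ge> 0"
    and u: "(\<Sum>n\<in>F. \<bar>u n\<bar> powr r) \<le> a powr r" and w: "(\<Sum>n\<in>F. \<bar>w n\<bar> powr r) \<le> b powr r"
  shows "(\<Sum>n\<in>F. \<bar>u n + w n\<bar> powr r) \<le> (a + b) powr r"
proof -
  \<comment> \<open>Division by a zero bound is impossible, but then the corresponding function
    vanishes on \<open>F\<close>.\<close>
  have null: "v n = 0" if "(\<Sum>n\<in>F. \<bar>v n\<bar> powr r) \<le> 0 powr r" "n \<in> F" for v :: "'a \<Rightarrow> real" and n
  proof -
    have "(\<Sum>n\<in>F. \<bar>v n\<bar> powr r) = 0" using that(1) sum_nonneg[of F "\<lambda>n. \<bar>v n\<bar> powr r"] by simp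
    then show ?thesis using F that(2) by (simp add: sum_nonneg_eq_0_iff)
  qed
  consider "a = 0" | "b = 0" | "a > 0" "b > 0" using ab by linarith
  then show ?thesis
  proof cases
    case 1
    then have "u n = 0" if "n \<in> F" for n using null[of u n] u that by simp
    with 1 w show ?thesis by simp
  next
    case 2
    then have "w n = 0" if "n \<in> F" for n using null[of w n] w that by simp
    with 2 u show ?thesis by simp
  next
    case 3
    define c where "c = a + b"
    have c: "c > 0" using 3 by (simp add: c_def)
    have st: "a / c > 0" "b / c > 0" "a / c + b / c = 1"
      using 3 c by (auto simp: c_def add_divide_distrib[symmetric])
    have "\<bar>u n + w n\<bar> powr r \<le> c powr r * (a / c * (\<bar>u n\<bar> powr r / a powr r) + b / c * (\<bar>w n\<bar> powr r / b powr r))"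
      for n
    proof -
      have "\<bar>u n + w n\<bar> powr r \<le> (\<bar>u n\<bar> + \<bar>w n\<bar>) powr r"
        using r by (intro powr_mono2) auto
      also have "\<bar>u n\<bar> + \<bar>w n\<bar> = c * (a / c * (\<bar>u n\<bar> / a) + b / c * (\<bar>w n\<bar> / b))"
        using 3 c by (simp add: field_simps)
      also have "\<dots> powr r = c powr r * (a / c * (\<bar>u n\<bar> / a) + b / c * (\<bar>w n\<bar> / b)) powr r"
        using c 3 by (intro powr_mult)
      also have "\<dots> \<le> c powr r * (a / c * (\<bar>u n\<bar> / a) powr r + b / c * (\<bar>w n\<bar> / b) powr r)"
        using 3 by (intro mult_left_mono powr_convex_nonneg[OF r st]) auto
      finally show ?thesis using 3 by (simp add: powr_divide)
    qed
    then have "(\<Sum>n\<in>F. \<bar>u n + w n\<bar> powr r)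
        \<le> (\<Sum>n\<in>F. c powr r * (a / c * (\<bar>u n\<bar> powr r / a powr r) + b / c * (\<bar>w n\<bar> powr r / b powr r)))"
      by (intro sum_mono)
    also have "\<dots> = c powr r * (a / c * ((\<Sum>n\<in>F. \<bar>u n\<bar> powr r) / a powr r) + b / c * ((\<Sum>n\<in>F. \<bar>w n\<bar> powr r) / b powr r))"
      by (simp only: sum_distrib_left[symmetric] sum.distrib sum_divide_distrib)
    also have "\<dots> \<le> c powr r * (a / c * 1 + b / c * 1)"
      using 3 c u w by (intro mult_left_mono add_mono) (auto simp: divide_le_eq)
    also have "\<dots> = c powr r" using st(3) by simp
    finally show ?thesis by (simp add: c_def)
  qed
qed

text \<open>Encodes membership together with norm at most \<open>C\<close> by finite partial sums
  alone, so that summability never has to be carried along. The sign condition is explicit because a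
  bound by \<open>C powr r\<close> does not enforce it.\<close>

definition lp_bounded :: "ereal \<Rightarrow> 'a set \<Rightarrow> real \<Rightarrow> ('a \<Rightarrow> real) \<Rightarrow> bool" where
  "lp_bounded p A C u \<longleftrightarrow> 0 \<le> C \<and>
     (if p = \<infinity> then \<forall>n\<in>A. \<bar>u n\<bar> \<le> C
      else \<forall>F. finite F \<longrightarrow> F \<subseteq> A \<longrightarrow> (\<Sum>n\<in>F. \<bar>u n\<bar> powr real_of_ereal p) \<le> C powr real_of_ereal p)"

context
  fixes p :: ereal and r :: real
  assumes p1: "1 \<le> p" and r_def: "r = real_of_ereal p"
begin

lemma exponent_ge_1: "p \<noteq> \<infinity> \<Longrightarrow> r \<ge> 1"
  using p1 by (cases p) (auto simp: r_def one_ereal_def)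

lemma lp_bounded_add:
  assumes "lp_bounded p A a u" "lp_bounded p A b w"
  shows "lp_bounded p A (a + b) (\<lambda>n. u n + w n)"
proof (cases "p = \<infinity>")
  case True
  then show ?thesis using assms by (force simp: lp_bounded_def)
next
  case False
  have "(\<Sum>n\<in>F. \<bar>u n + w n\<bar> powr r) \<le> (a + b) powr r" if F: "finite F" "F \<subseteq> A" for F
    by (rule Minkowski_finite_sum[OF exponent_ge_1[OF False] F(1)])
       (use assms False F in \<open>auto simp: lp_bounded_def r_def\<close>)
  then show ?thesis using False assms by (simp add: lp_bounded_def r_def)
qed

lemma lp_bounded_dominated:
  assumes "lp_bounded p A a u" "c \<ge> 0" "\<And>n. n \<in> A \<Longrightarrow> \<bar>w n\<bar> \<le> c * \<bar>u n\<bar>"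
  shows "lp_bounded p A (c * a) w"
proof (cases "p = \<infinity>")
  case True
  then have "\<bar>w n\<bar> \<le> c * a" if "n \<in> A" for n
    using assms that by (intro order_trans[OF assms(3)[OF that]] mult_left_mono) (auto simp: lp_bounded_def)
  then show ?thesis using True assms by (auto simp: lp_bounded_def)
next
  case False
  note r = exponent_ge_1[OF False]
  have "(\<Sum>n\<in>F. \<bar>w n\<bar> powr r) \<le> (c * a) powr r" if F: "finite F" "F \<subseteq> A" for F
  proof -
    have "(\<Sum>n\<in>F. \<bar>w n\<bar> powr r) \<le> (\<Sum>n\<in>F. (c * \<bar>u n\<bar>) powr r)"
      using F r assms(3) by (intro sum_mono powr_mono2) auto
    also have "\<dots> = c powr r * (\<Sum>n\<in>F. \<bar>u n\<bar> powr r)"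
      using assms(2) by (simp add: powr_mult sum_distrib_left)
    also have "\<dots> \<le> c powr r * a powr r"
      using assms(1) False F by (intro mult_left_mono) (auto simp: lp_bounded_def r_def)
    finally show ?thesis using assms by (simp add: powr_mult lp_bounded_def)
  qed
  then show ?thesis using assms False by (auto simp: lp_bounded_def r_def)
qed

lemma lp_bounded_pointwise:
  assumes "lp_bounded p A a u" "n \<in> A"
  shows "\<bar>u n\<bar> \<le> a"
proof (cases "p = \<infinity>")
  case False
  note r = exponent_ge_1[OF False]
  have "(\<Sum>n\<in>{n}. \<bar>u n\<bar> powr r) \<le> a powr r"
    using assms False unfolding lp_bounded_def r_def by (metis empty_subsetI finite.emptyI finite_insert insert_subset)
  then have "\<bar>u n\<bar> powr r \<le> a powr r" by simp
  then show ?thesis using r assms(1) powr_less_mono2[of r a "\<bar>u n\<bar>"]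
    by (force simp: lp_bounded_def not_less[symmetric])
qed (use assms in \<open>auto simp: lp_bounded_def\<close>)

text \<open>Fatou's lemma for counting measure: each inequality involves finitely many sites, or
  just one for infinite \<open>p\<close>, and therefore survives pointwise limits.\<close>

lemma lp_bounded_limit:
  assumes "\<And>k::nat. lp_bounded p A a (us k)" "\<And>n. n \<in> A \<Longrightarrow> (\<lambda>k. us k n) \<longlonglongrightarrow> w n"
  shows "lp_bounded p A a w"
proof (cases "p = \<infinity>")
  case True
  have "\<bar>w n\<bar> \<le> a" if "n \<in> A" for n
    by (rule LIMSEQ_le_const2[OF tendsto_rabs[OF assms(2)[OF that]]])
       (use assms(1) True that in \<open>auto simp: lp_bounded_def\<close>)
  then show ?thesis using True assms(1) by (auto simp: lp_bounded_def)
next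
  case False
  note r = exponent_ge_1[OF False]
  have "(\<Sum>n\<in>F. \<bar>w n\<bar> powr r) \<le> a powr r" if F: "finite F" "F \<subseteq> A" for F
  proof (rule LIMSEQ_le_const2)
    show "(\<lambda>k. \<Sum>n\<in>F. \<bar>us k n\<bar> powr r) \<longlonglongrightarrow> (\<Sum>n\<in>F. \<bar>w n\<bar> powr r)"
      using F r by (intro tendsto_sum tendsto_powr' tendsto_rabs assms(2) tendsto_const) auto
    show "\<exists>N. \<forall>k\<ge>N. (\<Sum>n\<in>F. \<bar>us k n\<bar> powr r) \<le> a powr r"
      using assms(1) False F by (auto simp: lp_bounded_def r_def)
  qed
  then show ?thesis using False assms(1) by (auto simp: lp_bounded_def r_def)
qed

lemma lp_bounded_reindex:
  assumes "lp_bounded p A a u" "inj_on f A" "f ` A \<subseteq> A"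
  shows "lp_bounded p A a (\<lambda>n. u (f n))"
proof (cases "p = \<infinity>")
  case False
  have "(\<Sum>n\<in>F. \<bar>u (f n)\<bar> powr r) \<le> a powr r" if F: "finite F" "F \<subseteq> A" for F
  proof -
    have "(\<Sum>n\<in>F. \<bar>u (f n)\<bar> powr r) = (\<Sum>n\<in>f ` F. \<bar>u n\<bar> powr r)"
      using F assms(2) by (subst sum.reindex) (auto intro: inj_on_subset)
    also have "\<dots> \<le> a powr r"
    proof -
      have "finite (f ` F)" "f ` F \<subseteq> A" using F assms(3) by auto
      then show ?thesis using assms(1) False unfolding lp_bounded_def r_def by simp
    qed
    finally show ?thesis .
  qed
  then show ?thesis using False assms(1) by (auto simp: lp_bounded_def r_def)
qed (use assms in \<open>auto simp: lp_bounded_def\<close>)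

section \<open>From finite sums to the spaces \<open>lp_space\<close>\<close>

lemma zero_mem_hlattice: "0 \<in> hlattice h"
  by (auto simp: hlattice_def intro: exI[of _ 0])

lemma lp_norm_nonneg:
  assumes "u \<in> lp_space p h" shows "0 \<le> lp_norm p h u"
proof (cases "p = \<infinity>")
  case True
  then have "bdd_above ((\<lambda>n. \<bar>u n\<bar>) ` hlattice h)" using assms by (simp add: lp_space_def)
  then have "\<bar>u 0\<bar> \<le> lp_norm p h u"
    using True zero_mem_hlattice by (auto simp: lp_norm_def intro!: cSUP_upper)
  then show ?thesis by linarith
qed (simp add: lp_norm_def)

text \<open>Membership and bound are kept in one statement because \<open>lp_norm\<close> is
  meaningful only on the space. Finite sums bound the infinite one from both sides: each is below
  it, and a common bound gives summability.\<close>

lemma lp_bounded_iff: "u \<in> lp_space p h \<and> lp_norm p h u \<le> C \<longleftrightarrow> lp_bounded p (hlattice h) C u"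
proof (cases "p = \<infinity>")
  case True
  show ?thesis
  proof
    assume u: "u \<in> lp_space p h \<and> lp_norm p h u \<le> C"
    then have "\<bar>u n\<bar> \<le> C" if "n \<in> hlattice h" for n
      using True that by (auto simp: lp_space_def lp_norm_def intro: order_trans[OF cSUP_upper[OF that]])
    moreover have "0 \<le> C" using u lp_norm_nonneg[of u h] by linarith
    ultimately show "lp_bounded p (hlattice h) C u" using True by (auto simp: lp_bounded_def)
  next
    assume "lp_bounded p (hlattice h) C u"
    then have *: "\<bar>u n\<bar> \<le> C" if "n \<in> hlattice h" for n using that True by (auto simp: lp_bounded_def)
    then have "u \<in> lp_space p h" using True bdd_aboveI2[OF *] by (simp add: lp_space_def)
    moreover have "lp_norm p h u \<le> C"
      using True * zero_mem_hlattice by (auto simp: lp_norm_def intro!: cSUP_least)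
    ultimately show "u \<in> lp_space p h \<and> lp_norm p h u \<le> C" ..
  qed
next
  case False
  note r = exponent_ge_1[OF False]
  let ?f = "\<lambda>n. \<bar>u n\<bar> powr r" and ?A = "hlattice h"
  show ?thesis
  proof
    assume u: "u \<in> lp_space p h \<and> lp_norm p h u \<le> C"
    then have s: "?f summable_on ?A" and le: "infsum ?f ?A powr (1 / r) \<le> C"
      using False by (auto simp: lp_space_def lp_norm_def r_def)
    have C: "0 \<le> C" using u lp_norm_nonneg[of u h] by linarith
    have "infsum ?f ?A = (infsum ?f ?A powr (1 / r)) powr r"
      using r by (simp add: powr_powr infsum_nonneg)
    also have "\<dots> \<le> C powr r" using le r by (intro powr_mono2) auto
    finally have "infsum ?f ?A \<le> C powr r" .
    moreover have "sum ?f F \<le> infsum ?f ?A" if "finite F" "F \<subseteq> ?A" for F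
      using s that by (intro finite_sum_le_infsum) auto
    ultimately show "lp_bounded p ?A C u" using False C by (force simp: lp_bounded_def r_def)
  next
    assume "lp_bounded p ?A C u"
    then have C: "0 \<le> C" and b: "\<And>F. finite F \<Longrightarrow> F \<subseteq> ?A \<Longrightarrow> sum ?f F \<le> C powr r"
      using False by (auto simp: lp_bounded_def r_def)
    have s: "?f summable_on ?A"
      by (rule nonneg_bounded_partial_sums_imp_summable_on[of _ _ "C powr r"])
         (use b in \<open>auto intro!: eventually_finite_subsets_at_top_weakI\<close>)
    then have "infsum ?f ?A \<le> C powr r" by (rule infsum_le_finite_sums) (use b in auto)
    then have "infsum ?f ?A powr (1 / r) \<le> (C powr r) powr (1 / r)"
      using r by (intro powr_mono2 infsum_nonneg) auto
    also have "\<dots> = C" using r C by (simp add: powr_powr)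
    finally show "u \<in> lp_space p h \<and> lp_norm p h u \<le> C"
      using s False by (simp add: lp_space_def lp_norm_def r_def)
  qed
qed

lemma lp_dominated:
  assumes "u \<in> lp_space p h" "c \<ge> 0" "\<And>n. n \<in> hlattice h \<Longrightarrow> \<bar>w n\<bar> \<le> c * \<bar>u n\<bar>"
  shows "w \<in> lp_space p h \<and> lp_norm p h w \<le> c * lp_norm p h u"
  unfolding lp_bounded_iff
  by (rule lp_bounded_dominated[OF _ assms(2,3)]) (use assms(1) lp_bounded_iff[of u] in auto)

lemma lp_reindex:
  fixes f :: "real ^ 'd \<Rightarrow> real ^ 'd"
  assumes "u \<in> lp_space p h" "inj_on f (hlattice h)" "f ` hlattice h \<subseteq> hlattice h"
  shows "(\<lambda>n. u (f n)) \<in> lp_space p h \<and> lp_norm p h (\<lambda>n. u (f n)) \<le> lp_norm p h u"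
  unfolding lp_bounded_iff
  by (rule lp_bounded_reindex[OF _ assms(2,3)]) (use assms(1) lp_bounded_iff[of u] in auto)

lemma fun_norm_lp: "fun_norm (hlattice h) (lp_space p h) (lp_norm p h)"
proof
  have self: "lp_bounded p (hlattice h) (lp_norm p h u) u" if "u \<in> lp_space p h" for u
    using that lp_bounded_iff by blast
  have "lp_bounded p (hlattice h) 0 (\<lambda>_. 0)" by (simp add: lp_bounded_def)
  then show "(\<lambda>_. 0) \<in> lp_space p h" using lp_bounded_iff by blast
  show "(\<lambda>n. u n + w n) \<in> lp_space p h" "lp_norm p h (\<lambda>n. u n + w n) \<le> lp_norm p h u + lp_norm p h w"
    if "u \<in> lp_space p h" "w \<in> lp_space p h" for u w
    using lp_bounded_add[OF self[OF that(1)] self[OF that(2)]] lp_bounded_iff by blast+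
  have scale: "(\<lambda>n. c * u n) \<in> lp_space p h \<and> lp_norm p h (\<lambda>n. c * u n) \<le> \<bar>c\<bar> * lp_norm p h u"
    if "u \<in> lp_space p h" for u c
    by (rule lp_dominated[OF that]) (auto simp: abs_mult)
  then show "(\<lambda>n. c * u n) \<in> lp_space p h" if "u \<in> lp_space p h" for u c using that by blast
  show "lp_norm p h (\<lambda>n. c * u n) = \<bar>c\<bar> * lp_norm p h u" if u: "u \<in> lp_space p h" for u c
  proof (cases "c = 0")
    case True
    then show ?thesis
      using scale[OF u, of c] lp_norm_nonneg[of "\<lambda>n. c * u n" h] by simp
  next
    case False
    \<comment> \<open>Homogeneity follows from its one-sided form, used for the factor
      \<open>c\<close> and for its inverse.\<close>
    then have "lp_norm p h u \<le> \<bar>1 / c\<bar> * lp_norm p h (\<lambda>n. c * u n)"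
      using scale[of "\<lambda>n. c * u n" "1 / c"] scale[OF u, of c] by simp
    then have "\<bar>c\<bar> * lp_norm p h u \<le> lp_norm p h (\<lambda>n. c * u n)"
      using False by (simp add: field_simps abs_divide)
    then show ?thesis using scale[OF u, of c] by simp
  qed
  show "\<bar>u n\<bar> \<le> lp_norm p h u" if "u \<in> lp_space p h" "n \<in> hlattice h" for u n
    using lp_bounded_pointwise[OF self[OF that(1)] that(2)] .
  show "w \<in> lp_space p h \<and> lp_norm p h w \<le> C"
    if "\<And>k. us k \<in> lp_space p h" "\<And>k. lp_norm p h (us k) \<le> C"
      "\<And>n. n \<in> hlattice h \<Longrightarrow> (\<lambda>k. us k n) \<longlonglongrightarrow> w n" for us :: "nat \<Rightarrow> _" and C w
    using that unfolding lp_bounded_iff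
    by (intro lp_bounded_limit[of _ C us w]) (use lp_bounded_iff in blast)+
qed

end

text \<open>A pair of sequences becomes one function on the disjoint union \<open>A <+> A\<close>,
  so the theory of a single unknown covers the first-order system, with the norm of
  \<open>X0_dist\<close>.\<close>

lemma fun_norm_sum:
  assumes "fun_norm A X N"
  shows "fun_norm (A <+> A) {w. (\<lambda>n. w (Inl n)) \<in> X \<and> (\<lambda>n. w (Inr n)) \<in> X}
    (\<lambda>w. N (\<lambda>n. w (Inl n)) + N (\<lambda>n. w (Inr n)))"
proof -
  interpret fun_norm A X N by (rule assms)
  show ?thesis
  proof (unfold_locales, goal_cases)
    case (4 u w)
    then show ?case
      using N_add[of "\<lambda>n. u (Inl n)" "\<lambda>n. w (Inl n)"] N_add[of "\<lambda>n. u (Inr n)" "\<lambda>n. w (Inr n)"] by simp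
  next
    case (6 u n)
    then show ?case
      using pointwise[of "\<lambda>n. u (Inl n)"] pointwise[of "\<lambda>n. u (Inr n)"] N_nonneg[of "\<lambda>n. u (Inl n)"]
        N_nonneg[of "\<lambda>n. u (Inr n)"] by force
  next
    case (7 us C w)
    define a where "a k = N (\<lambda>n. us k (Inl n))" for k
    define b where "b k = N (\<lambda>n. us k (Inr n))" for k
    have mem: "(\<lambda>n. us k (Inl n)) \<in> X" "(\<lambda>n. us k (Inr n)) \<in> X" for k using 7(1)[of k] by auto
    have ab: "0 \<le> a k" "0 \<le> b k" "a k + b k \<le> C" for k
      using mem[of k] 7(2)[of k] by (auto simp: a_def b_def N_nonneg)
    \<comment> \<open>The bound \<open>C\<close> controls only the sum of the two norms. Along a
      subsequence the first norm converges to some \<open>l\<close>; then the two limits have norms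
      at most \<open>l\<close> and \<open>C - l\<close>.\<close>
    have "\<bar>a k\<bar> \<le> C" for k using ab[of k] by linarith
    then have "bounded (range a)" by (auto simp: bounded_iff)
    then obtain l r where r: "strict_mono (r :: nat \<Rightarrow> nat)" and l: "(a \<circ> r) \<longlonglongrightarrow> l"
      using bounded_imp_convergent_subsequence by blast
    have lim: "(\<lambda>k. us (r k) n) \<longlonglongrightarrow> w n" if "n \<in> A <+> A" for n
      using LIMSEQ_subseq_LIMSEQ[OF 7(3)[OF that] r] by (simp add: o_def)
    have "(\<lambda>n. w (Inl n)) \<in> X" "N (\<lambda>n. w (Inl n)) \<le> l"
      by (rule fatou_tendsto[of "\<lambda>k n. us (r k) (Inl n)" "a \<circ> r" l]; use mem l lim in \<open>auto simp: a_def\<close>)+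
    moreover have "(\<lambda>k. C - (a \<circ> r) k) \<longlonglongrightarrow> C - l" using l by (intro tendsto_intros)
    then have "(\<lambda>n. w (Inr n)) \<in> X \<and> N (\<lambda>n. w (Inr n)) \<le> C - l"
      using fatou_tendsto[of "\<lambda>k n. us (r k) (Inr n)" "\<lambda>k. C - (a \<circ> r) k" "C - l" "\<lambda>n. w (Inr n)"] mem lim ab
      by (auto simp: b_def le_diff_eq add.commute)
    ultimately show ?case by simp
  qed (auto simp: zero add scale N_scale distrib_left)
qed

section \<open>The Klein-Gordon system\<close>

lemma powr_mult_self_increment:
  fixes s R x y :: real
  assumes s: "s > 0" and y: "0 \<le> y" and yx: "y \<le> x" and x: "x \<le> R"
  shows "\<bar>x powr s * x - y powr s * y\<bar> \<le> (s + 1) * R powr s * (x - y)"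
proof (cases "x = y")
  case False
  have eq: "z powr s * z = z powr (s + 1)" if "0 \<le> z" for z :: real
    using that by (simp add: powr_add)
  have "\<exists>z. y < z \<and> z < x \<and> x powr (s + 1) - y powr (s + 1) = (x - y) * ((s + 1) * z powr s)"
  proof -
    have "continuous_on {y..x} (\<lambda>z. z powr (s + 1))"
      using s y by (intro continuous_on_powr') (auto intro!: continuous_intros)
    \<comment> \<open>Only interior points matter to the mean value theorem; there
      \<open>z > y \<ge> 0\<close>, so the power is differentiated away from 0.\<close>
    moreover have der: "((\<lambda>z. z powr (s + 1)) has_real_derivative (s + 1) * z powr s) (at z)"
      if "y < z" "z < x" for z
      using has_real_derivative_powr[of z "s + 1"] that y by simp
    then have "(\<lambda>z. z powr (s + 1)) differentiable (at z)" if "y < z" "z < x" for z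
      using that real_differentiable_def by blast
    ultimately obtain l z where z: "y < z" "z < x" "((\<lambda>z. z powr (s + 1)) has_real_derivative l) (at z)"
      "x powr (s + 1) - y powr (s + 1) = (x - y) * l"
      using MVT[of y x "\<lambda>z. z powr (s + 1)"] False yx by auto
    then show ?thesis using DERIV_unique[OF z(3) der[OF z(1,2)]] by auto
  qed
  then obtain z where z: "y < z" "z < x"
    "x powr (s + 1) - y powr (s + 1) = (x - y) * ((s + 1) * z powr s)" by blast
  have "z powr s \<le> R powr s" using z y x s by (intro powr_mono2) auto
  then have "(x - y) * ((s + 1) * z powr s) \<le> (x - y) * ((s + 1) * R powr s)"
    using s yx by (intro mult_left_mono) auto
  moreover have "0 \<le> (x - y) * ((s + 1) * z powr s)" using s yx by simp
  ultimately show ?thesis using z(3) eq[of x] eq[of y] y yx by (simp add: mult.commute)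
qed simp

text \<open>On either half line odd symmetry reduces this to the increment of a power. For opposite
  signs the magnitudes of both terms add up, as do the distances of \<open>x\<close> and
  \<open>y\<close> from 0, and the constant \<open>R powr s\<close> suffices.\<close>

lemma abs_powr_mult_lipschitz:
  fixes s R x y :: real
  assumes s: "s > 0" and x: "\<bar>x\<bar> \<le> R" and y: "\<bar>y\<bar> \<le> R"
  shows "\<bar>\<bar>x\<bar> powr s * x - \<bar>y\<bar> powr s * y\<bar> \<le> (s + 1) * R powr s * \<bar>x - y\<bar>"
proof -
  have opposite: "\<bar>\<bar>x\<bar> powr s * x - \<bar>y\<bar> powr s * y\<bar> \<le> (s + 1) * R powr s * \<bar>x - y\<bar>"
    if xy: "y \<le> 0" "0 \<le> x" and R: "\<bar>x\<bar> \<le> R" "\<bar>y\<bar> \<le> R" for x y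
  proof -
    define P where "P = \<bar>x\<bar> powr s * x"
    define Q where "Q = \<bar>y\<bar> powr s * (- y)"
    have le: "P \<le> R powr s * x" "Q \<le> R powr s * (- y)"
      unfolding P_def Q_def using xy R s by (intro mult_right_mono powr_mono2; simp)+
    have nonneg: "0 \<le> P" "0 \<le> Q"
      unfolding P_def Q_def using xy by (intro mult_nonneg_nonneg; simp)+
    have "\<bar>\<bar>x\<bar> powr s * x - \<bar>y\<bar> powr s * y\<bar> = \<bar>P + Q\<bar>" by (simp add: P_def Q_def)
    also have "\<dots> \<le> R powr s * x + R powr s * (- y)" using le nonneg by linarith
    also have "\<dots> = 1 * R powr s * \<bar>x - y\<bar>" using xy by (simp add: algebra_simps)
    also have "\<dots> \<le> (s + 1) * R powr s * \<bar>x - y\<bar>" using s by (intro mult_right_mono) auto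
    finally show ?thesis .
  qed
  consider "0 \<le> y" "y \<le> x" | "0 \<le> x" "x \<le> y" | "y \<le> 0" "0 \<le> x" | "x \<le> 0" "0 \<le> y"
    | "x \<le> y" "y \<le> 0" | "y \<le> x" "x \<le> 0" by linarith
  then show ?thesis
  proof cases
    case 1 then show ?thesis using powr_mult_self_increment[OF s, of y x R] x by simp
  next
    case 2 then show ?thesis using powr_mult_self_increment[OF s, of x y R] y by (simp add: abs_minus_commute)
  next
    case 3 then show ?thesis using opposite x y by blast
  next
    case 4 then show ?thesis using opposite[of x y] x y by (simp add: abs_minus_commute)
  next
    case 5 then show ?thesis
      using powr_mult_self_increment[OF s, of "- y" "- x" R] x by (simp add: abs_minus_commute)
  next
    case 6 then show ?thesis using powr_mult_self_increment[OF s, of "- x" "- y" R] y by simp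
  qed
qed

text \<open>Suprema in \<open>ereal\<close> allow infinite lifespans. Openness excludes both
  endpoints: around each \<open>t\<close> in \<open>I\<close> the points at distance
  \<open>d / 2\<close> still belong to \<open>I\<close>.\<close>

lemma open_interval_eq_time_interval:
  assumes "open I" "is_interval I" "0 \<in> I"
  obtains Tmin Tmax where "0 < Tmin" "0 < Tmax" "I = time_interval Tmin Tmax"
proof -
  define Tmin where "Tmin = (SUP t\<in>I. ereal (- t))"
  define Tmax where "Tmax = (SUP t\<in>I. ereal t)"
  have I: "- Tmin < ereal t \<and> ereal t < Tmax" if t: "t \<in> I" for t
  proof -
    obtain d where d: "d > 0" "ball t d \<subseteq> I" using assms(1) t open_contains_ball by blast
    then have "t + d / 2 \<in> I" "t - d / 2 \<in> I" by (auto simp: dist_real_def)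
    then have "ereal (t + d / 2) \<le> Tmax" "ereal (- (t - d / 2)) \<le> Tmin"
      unfolding Tmax_def Tmin_def by (auto intro: SUP_upper2)
    moreover have "ereal t < ereal (t + d / 2)" "ereal (- t) < ereal (- (t - d / 2))" using d(1) by auto
    ultimately have "ereal t < Tmax" "- ereal t < Tmin" by (metis less_le_trans uminus_ereal.simps(1))+
    then show ?thesis by (metis ereal_uminus_less_reorder)
  qed
  have "t \<in> I" if t: "- Tmin < ereal t" "ereal t < Tmax" for t
  proof -
    obtain b where b: "b \<in> I" "t < b" using t(2) by (auto simp: Tmax_def less_SUP_iff)
    have "ereal (- t) < Tmin" using t(1) by (metis ereal_uminus_less_reorder uminus_ereal.simps(1))
    then obtain a where a: "a \<in> I" "a < t" by (auto simp: Tmin_def less_SUP_iff)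
    show ?thesis using a b assms(2) unfolding is_interval_1 by (metis less_imp_le)
  qed
  with I have "I = time_interval Tmin Tmax" by (auto simp: time_interval_def)
  moreover have "0 < Tmax" "0 < Tmin"
    using I[OF assms(3)] by (metis ereal_uminus_less_reorder ereal_uminus_zero zero_ereal_def)+
  ultimately show thesis using that by blast
qed

lemma is_interval_time_interval: "is_interval (time_interval Tmin Tmax)"
  unfolding is_interval_1 time_interval_def
  by (auto; meson ereal_less_eq(3) le_less_trans less_le_trans)

section \<open>Estimates for the Klein-Gordon field\<close>

locale dnlkg =
  fixes h \<sigma> lam :: real and p :: ereal and V :: "real ^ 'd \<Rightarrow> real"
  assumes sigma_pos: "0 < \<sigma>" and p_ge_1: "1 \<le> p" and V_bounded: "bounded (V ` hlattice h)"
begin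

sublocale lp: fun_norm "hlattice h :: (real ^ 'd) set" "lp_space p h" "lp_norm p h"
  by (rule fun_norm_lp[OF p_ge_1 refl])

sublocale pair: fun_norm "hlattice h <+> hlattice h :: (real ^ 'd + real ^ 'd) set"
  "{w. (\<lambda>n. w (Inl n)) \<in> lp_space p h \<and> (\<lambda>n. w (Inr n)) \<in> lp_space p h}"
  "\<lambda>w. lp_norm p h (\<lambda>n. w (Inl n)) + lp_norm p h (\<lambda>n. w (Inr n))"
  by (rule fun_norm_sum[OF lp.fun_norm_axioms])

definition acceleration :: "(real ^ 'd \<Rightarrow> real) \<Rightarrow> real ^ 'd \<Rightarrow> real" where
  "acceleration u n = discrete_laplacian h u n - V n * u n - lam * (\<bar>u n\<bar> powr (2 * \<sigma>) * u n)"

definition phase_field :: "(real ^ 'd + real ^ 'd \<Rightarrow> real) \<Rightarrow> real ^ 'd + real ^ 'd \<Rightarrow> real" where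
  "phase_field w = case_sum (\<lambda>n. w (Inr n)) (acceleration (\<lambda>n. w (Inl n)))"

lemma lp_shift:
  fixes u :: "real ^ 'd \<Rightarrow> real"
  assumes "u \<in> lp_space p h"
  shows "(\<lambda>n. u (n + h *\<^sub>R axis j 1)) \<in> lp_space p h \<and> lp_norm p h (\<lambda>n. u (n + h *\<^sub>R axis j 1)) \<le> lp_norm p h u"
    and "(\<lambda>n. u (n - h *\<^sub>R axis j 1)) \<in> lp_space p h \<and> lp_norm p h (\<lambda>n. u (n - h *\<^sub>R axis j 1)) \<le> lp_norm p h u"
proof -
  have 1: "n + h *\<^sub>R axis j 1 \<in> hlattice h" "n - h *\<^sub>R axis j 1 \<in> hlattice h"
    if n: "n \<in> hlattice h" for n :: "real ^ 'd"
  proof -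
    obtain k :: "'d \<Rightarrow> int" where k: "\<And>i. n $ i = h * of_int (k i)"
      using n choice[of "\<lambda>i k. n $ i = h * of_int k"] by (auto simp: hlattice_def)
    have "(n + h *\<^sub>R axis j 1) $ i = h * of_int (k i + (if i = j then 1 else 0))"
      "(n - h *\<^sub>R axis j 1) $ i = h * of_int (k i - (if i = j then 1 else 0))" for i
      by (auto simp: k axis_def algebra_simps)
    then show "n + h *\<^sub>R axis j 1 \<in> hlattice h" "n - h *\<^sub>R axis j 1 \<in> hlattice h"
      unfolding hlattice_def by blast+
  qed
  show "(\<lambda>n. u (n + h *\<^sub>R axis j 1)) \<in> lp_space p h \<and> lp_norm p h (\<lambda>n. u (n + h *\<^sub>R axis j 1)) \<le> lp_norm p h u"
    by (rule lp_reindex[OF p_ge_1 refl assms]) (use 1 in \<open>auto simp: inj_on_def\<close>)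
  show "(\<lambda>n. u (n - h *\<^sub>R axis j 1)) \<in> lp_space p h \<and> lp_norm p h (\<lambda>n. u (n - h *\<^sub>R axis j 1)) \<le> lp_norm p h u"
    by (rule lp_reindex[OF p_ge_1 refl assms]) (use 1 in \<open>auto simp: inj_on_def\<close>)
qed

text \<open>In each direction there are two translates, neither of larger norm than
  \<open>u\<close>, and \<open>2 * u\<close>: together 4, scaled by the inverse square of
  \<open>h\<close> and summed over the dimensions.\<close>

lemma discrete_laplacian_bounded:
  fixes u :: "real ^ 'd \<Rightarrow> real"
  assumes u: "u \<in> lp_space p h"
  shows "discrete_laplacian h u \<in> lp_space p h \<and>
    lp_norm p h (discrete_laplacian h u) \<le> real CARD('d) * (4 / h\<^sup>2) * lp_norm p h u"
proof -
  let ?N = "lp_norm p h"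
  define a where "a j n = 1 / h\<^sup>2 * ((u (n + h *\<^sub>R axis j 1) + u (n - h *\<^sub>R axis j 1)) + (-2) * u n)" for j n
  have a: "a j \<in> lp_space p h \<and> ?N (a j) \<le> 4 / h\<^sup>2 * ?N u" for j
  proof -
    note s = lp_shift[OF u, of j]
    have 1: "(\<lambda>n. u (n + h *\<^sub>R axis j 1) + u (n - h *\<^sub>R axis j 1)) \<in> lp_space p h"
      "?N (\<lambda>n. u (n + h *\<^sub>R axis j 1) + u (n - h *\<^sub>R axis j 1)) \<le> 2 * ?N u"
      using lp.add lp.N_add[of "\<lambda>n. u (n + h *\<^sub>R axis j 1)" "\<lambda>n. u (n - h *\<^sub>R axis j 1)"] s by auto
    have 2: "(\<lambda>n. (-2) * u n) \<in> lp_space p h" "?N (\<lambda>n. (-2) * u n) = 2 * ?N u"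
      using lp.scale[OF u, of "-2"] lp.N_scale[OF u, of "-2"] by auto
    let ?b = "\<lambda>n. (u (n + h *\<^sub>R axis j 1) + u (n - h *\<^sub>R axis j 1)) + (-2) * u n"
    have 3: "?b \<in> lp_space p h" "?N ?b \<le> 4 * ?N u"
      using lp.add[OF 1(1) 2(1)] lp.N_add[OF 1(1) 2(1)] 1(2) 2(2) by auto
    have "a j = (\<lambda>n. 1 / h\<^sup>2 * ?b n)" by (simp add: a_def fun_eq_iff)
    then have "a j \<in> lp_space p h" "?N (a j) = 1 / h\<^sup>2 * ?N ?b"
      using lp.scale[OF 3(1), of "1 / h\<^sup>2"] lp.N_scale[OF 3(1), of "1 / h\<^sup>2"] by auto
    moreover have "1 / h\<^sup>2 * ?N ?b \<le> 1 / h\<^sup>2 * (4 * ?N u)" using 3(2) by (intro mult_left_mono) auto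
    ultimately show ?thesis by simp
  qed
  have eq: "discrete_laplacian h u = (\<lambda>n. \<Sum>j\<in>UNIV. a j n)"
    by (simp add: discrete_laplacian_def a_def fun_eq_iff)
  have "(\<Sum>j\<in>UNIV. ?N (a j)) \<le> (\<Sum>j\<in>(UNIV :: 'd set). 4 / h\<^sup>2 * ?N u)"
    using a by (intro sum_mono) blast
  then show ?thesis
    using lp.sum_mem_N_le[of "UNIV :: 'd set" a] a unfolding eq by auto
qed

lemma discrete_laplacian_diff:
  "discrete_laplacian h (\<lambda>n. u n - w n) n = discrete_laplacian h u n - discrete_laplacian h w n"
  unfolding discrete_laplacian_def sum_subtractf[symmetric]
  by (intro sum.cong refl) (simp add: algebra_simps diff_divide_distrib add_divide_distrib)

lemma acceleration_mem:
  assumes u: "u \<in> lp_space p h"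
  shows "acceleration u \<in> lp_space p h"
proof -
  obtain B where B: "B \<ge> 0" "\<And>n. n \<in> hlattice h \<Longrightarrow> \<bar>V n\<bar> \<le> B"
    using V_bounded by (auto simp: bounded_pos intro: less_imp_le)
  have V: "(\<lambda>n. V n * u n) \<in> lp_space p h"
    using lp_dominated[OF p_ge_1 refl u B(1)] B(2) by (auto simp: abs_mult mult_right_mono)
  \<comment> \<open>The inclusion of l^p in l^inf turns the nonlinearity into a multiple of
    \<open>u\<close>, with no relation between \<open>\<sigma>\<close> and \<open>p\<close>.\<close>
  have "\<bar>\<bar>u n\<bar> powr (2 * \<sigma>) * u n\<bar> \<le> lp_norm p h u powr (2 * \<sigma>) * \<bar>u n\<bar>" if "n \<in> hlattice h" for n
    using lp.pointwise[OF u that] sigma_pos by (auto simp: abs_mult intro!: mult_right_mono powr_mono2)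
  then have phi: "(\<lambda>n. \<bar>u n\<bar> powr (2 * \<sigma>) * u n) \<in> lp_space p h"
    using lp_dominated[OF p_ge_1 refl u] by (meson powr_ge_zero)
  show ?thesis
    unfolding acceleration_def[abs_def]
    by (intro lp.diff lp.scale phi V conjunct1[OF discrete_laplacian_bounded[OF u]])
qed

lemma acceleration_locally_lipschitz:
  "\<exists>L. \<forall>u\<in>lp_space p h. \<forall>w\<in>lp_space p h. lp_norm p h u \<le> R \<longrightarrow> lp_norm p h w \<le> R \<longrightarrow>
     lp.D (acceleration u) (acceleration w) \<le> L * lp.D u w"
proof -
  obtain B where B: "B \<ge> 0" "\<And>n. n \<in> hlattice h \<Longrightarrow> \<bar>V n\<bar> \<le> B"
    using V_bounded by (auto simp: bounded_pos intro: less_imp_le)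
  \<comment> \<open>The summands belong to the Laplacian, the potential and the nonlinearity; only
    the last grows with the ball.\<close>
  define L where "L = real CARD('d) * (4 / h\<^sup>2) + B + \<bar>lam\<bar> * ((2 * \<sigma> + 1) * R powr (2 * \<sigma>))"
  have "lp.D (acceleration u) (acceleration w) \<le> L * lp.D u w"
    if u: "u \<in> lp_space p h" "lp_norm p h u \<le> R" and w: "w \<in> lp_space p h" "lp_norm p h w \<le> R" for u w
  proof -
    define z where "z n = u n - w n" for n
    have z: "z \<in> lp_space p h" unfolding z_def[abs_def] using u(1) w(1) by (rule lp.diff)
    define a where "a n = (-1) * (V n * z n)" for n
    define b where "b n = (- lam) * (\<bar>u n\<bar> powr (2 * \<sigma>) * u n - \<bar>w n\<bar> powr (2 * \<sigma>) * w n)" for n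
    have a: "a \<in> lp_space p h \<and> lp_norm p h a \<le> B * lp_norm p h z"
      by (rule lp_dominated[OF p_ge_1 refl z B(1)])
         (use B(2) in \<open>auto simp: a_def abs_mult intro!: mult_right_mono\<close>)
    have b: "b \<in> lp_space p h \<and> lp_norm p h b \<le> \<bar>lam\<bar> * ((2 * \<sigma> + 1) * R powr (2 * \<sigma>)) * lp_norm p h z"
    proof (rule lp_dominated[OF p_ge_1 refl z])
      show "0 \<le> \<bar>lam\<bar> * ((2 * \<sigma> + 1) * R powr (2 * \<sigma>))" using sigma_pos by simp
      fix n :: "real ^ 'd" assume n: "n \<in> hlattice h"
      have "\<bar>\<bar>u n\<bar> powr (2 * \<sigma>) * u n - \<bar>w n\<bar> powr (2 * \<sigma>) * w n\<bar> \<le> (2 * \<sigma> + 1) * R powr (2 * \<sigma>) * \<bar>z n\<bar>"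
        unfolding z_def using lp.pointwise[OF u(1) n] lp.pointwise[OF w(1) n] u(2) w(2) sigma_pos
        by (intro abs_powr_mult_lipschitz) auto
      then show "\<bar>b n\<bar> \<le> \<bar>lam\<bar> * ((2 * \<sigma> + 1) * R powr (2 * \<sigma>)) * \<bar>z n\<bar>"
        unfolding b_def abs_mult by (simp add: mult.assoc mult_left_mono)
    qed
    note l = discrete_laplacian_bounded[OF z]
    have ab: "(\<lambda>n. a n + b n) \<in> lp_space p h" using a b lp.add by blast
    have "(\<lambda>n. acceleration u n - acceleration w n) = (\<lambda>n. discrete_laplacian h z n + (a n + b n))"
      by (auto simp: acceleration_def a_def b_def z_def[abs_def] discrete_laplacian_diff algebra_simps)
    then have "lp.D (acceleration u) (acceleration w) \<le>
        lp_norm p h (discrete_laplacian h z) + (lp_norm p h a + lp_norm p h b)"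
      unfolding lp.D_def
      using lp.N_add[OF conjunct1[OF l] ab] lp.N_add[OF conjunct1[OF a] conjunct1[OF b]] by simp
    also have "\<dots> \<le> L * lp_norm p h z"
      using a b l by (simp add: L_def distrib_right)
    finally show ?thesis by (simp add: lp.D_def z_def[abs_def])
  qed
  then show ?thesis by blast
qed

lemma pair_D_eq:
  "pair.D w z = lp.D (\<lambda>n. w (Inl n)) (\<lambda>n. z (Inl n)) + lp.D (\<lambda>n. w (Inr n)) (\<lambda>n. z (Inr n))"
  by (simp add: pair.D_def lp.D_def)

lemma phase_field_locally_lipschitz: "pair.locally_lipschitz phase_field"
  unfolding pair.locally_lipschitz_def
proof (intro conjI ballI allI)
  fix R
  obtain L where L: "\<And>u w. u \<in> lp_space p h \<Longrightarrow> w \<in> lp_space p h \<Longrightarrow> lp_norm p h u \<le> R \<Longrightarrow>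
      lp_norm p h w \<le> R \<Longrightarrow> lp.D (acceleration u) (acceleration w) \<le> L * lp.D u w"
    using acceleration_locally_lipschitz[of R] by blast
  show "\<exists>L. \<forall>w\<in>{w. (\<lambda>n. w (Inl n)) \<in> lp_space p h \<and> (\<lambda>n. w (Inr n)) \<in> lp_space p h}.
      \<forall>z\<in>{w. (\<lambda>n. w (Inl n)) \<in> lp_space p h \<and> (\<lambda>n. w (Inr n)) \<in> lp_space p h}.
      lp_norm p h (\<lambda>n. w (Inl n)) + lp_norm p h (\<lambda>n. w (Inr n)) \<le> R \<longrightarrow>
      lp_norm p h (\<lambda>n. z (Inl n)) + lp_norm p h (\<lambda>n. z (Inr n)) \<le> R \<longrightarrow>
      pair.D (phase_field w) (phase_field z) \<le> L * pair.D w z"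
  \<comment> \<open>The 1 serves the first component of the field, which merely copies the velocity;
    \<open>L\<close> serves the acceleration.\<close>
  proof (intro exI[of _ "max L 1"] ballI impI, clarsimp)
    fix w z :: "real ^ 'd + real ^ 'd \<Rightarrow> real"
    assume mem: "(\<lambda>n. w (Inl n)) \<in> lp_space p h" "(\<lambda>n. w (Inr n)) \<in> lp_space p h"
      "(\<lambda>n. z (Inl n)) \<in> lp_space p h" "(\<lambda>n. z (Inr n)) \<in> lp_space p h"
      and R: "lp_norm p h (\<lambda>n. w (Inl n)) + lp_norm p h (\<lambda>n. w (Inr n)) \<le> R"
        "lp_norm p h (\<lambda>n. z (Inl n)) + lp_norm p h (\<lambda>n. z (Inr n)) \<le> R"
    let ?dl = "lp.D (\<lambda>n. w (Inl n)) (\<lambda>n. z (Inl n))" and ?dr = "lp.D (\<lambda>n. w (Inr n)) (\<lambda>n. z (Inr n))"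
    have "pair.D (phase_field w) (phase_field z) =
        ?dr + lp.D (acceleration (\<lambda>n. w (Inl n))) (acceleration (\<lambda>n. z (Inl n)))"
      by (simp add: pair_D_eq phase_field_def)
    also have "\<dots> \<le> ?dr + L * ?dl"
      using L[OF mem(1,3)] R lp.N_nonneg[OF mem(2)] lp.N_nonneg[OF mem(4)] by simp
    also have "\<dots> \<le> max L 1 * ?dr + max L 1 * ?dl"
      using lp.D_nonneg[OF mem(1,3)] lp.D_nonneg[OF mem(2,4)] mult_right_mono[of 1 "max L 1" ?dr]
        mult_right_mono[of L "max L 1" ?dl] by simp
    finally show "pair.D (phase_field w) (phase_field z) \<le> max L 1 * pair.D w z"
      by (simp add: pair_D_eq distrib_left)
  qed
qed (auto simp: phase_field_def acceleration_mem)

text \<open>The equation determines the second derivative, so the existential over \<open>a\<close>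
  says exactly that \<open>v\<close> has the acceleration as its derivative. The rest is the
  identification of a pair with a function on the disjoint union.\<close>

lemma dnlkg_solution_iff:
  "dnlkg_solution p h \<sigma> lam V I f g u v \<longleftrightarrow>
     pair.solves phase_field I (\<lambda>t. case_sum (u t) (v t)) \<and>
     (\<forall>n\<in>hlattice h. u 0 n = f n \<and> v 0 n = g n)"
proof -
  have "X0_continuous_on p h I (\<lambda>t. (u t, v t)) \<longleftrightarrow> pair.norm_continuous_on I (\<lambda>t. case_sum (u t) (v t))"
    by (simp add: X0_continuous_on_def pair.norm_continuous_on_def X0_space_def X0_dist_def
        pair_D_eq lp.D_def)
  moreover have "(\<exists>a. ((\<lambda>s. v s n) has_real_derivative a) (at t within I) \<and>
        a - discrete_laplacian h (u t) n + V n * u t n + lam * \<bar>u t n\<bar> powr (2 * \<sigma>) * u t n = 0) \<longleftrightarrow>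
      ((\<lambda>s. v s n) has_real_derivative acceleration (u t) n) (at t within I)" for t n
  proof -
    have "a - discrete_laplacian h (u t) n + V n * u t n + lam * \<bar>u t n\<bar> powr (2 * \<sigma>) * u t n = 0
      \<longleftrightarrow> a = acceleration (u t) n" for a
      by (auto simp: acceleration_def algebra_simps)
    then show ?thesis by auto
  qed
  ultimately show ?thesis
    unfolding dnlkg_solution_def pair.solves_def
    by (simp add: phase_field_def Plus_def ball_Un ball_conj_distrib conj_ac)
qed

section \<open>Well-posedness of the Klein-Gordon equation\<close>

lemma pair_D_case_sum:
  "pair.D (case_sum u v) (case_sum u' v') = X0_dist p h (u, v) (u', v')"
  by (simp add: pair_D_eq lp.D_def X0_dist_def)

lemma dnlkg_unique:
  assumes "dnlkg_solution p h \<sigma> lam V I f g u v" "dnlkg_solution p h \<sigma> lam V I f g u' v'"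
    and I: "is_interval I" "0 \<in> I" and t: "t \<in> I" and n: "n \<in> hlattice h"
  shows "u t n = u' t n \<and> v t n = v' t n"
proof -
  have "case_sum (u t) (v t) m = case_sum (u' t) (v' t) m" if "m \<in> hlattice h <+> hlattice h" for m
    by (rule pair.solution_unique[OF phase_field_locally_lipschitz _ _ I _ t that])
       (use assms in \<open>auto simp: dnlkg_solution_iff\<close>)
  from this[of "Inl n"] this[of "Inr n"] n show ?thesis by auto
qed

lemma dnlkg_maximal_existence: "maximal_existence p h \<sigma> lam V"
  unfolding maximal_existence_def
proof (intro allI impI)
  fix f g :: "real ^ 'd \<Rightarrow> real"
  assume "(f, g) \<in> X0_space p h"
  then have "case_sum f g \<in> {w. (\<lambda>n. w (Inl n)) \<in> lp_space p h \<and> (\<lambda>n. w (Inr n)) \<in> lp_space p h}"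
    by (simp add: X0_space_def)
  from pair.maximal_solution_exists[OF phase_field_locally_lipschitz this]
  obtain I x where I: "open I" "is_interval I" "0 \<in> I" and x: "pair.solves phase_field I x"
    and init: "\<forall>n\<in>hlattice h <+> hlattice h. x 0 n = case_sum f g n"
    and max: "\<forall>J y. is_interval J \<and> 0 \<in> J \<and> pair.solves phase_field J y \<and>
      (\<forall>n\<in>hlattice h <+> hlattice h. y 0 n = case_sum f g n) \<longrightarrow> J \<subseteq> I"
    by blast
  obtain Tmin Tmax where T: "0 < Tmin" "0 < Tmax" "I = time_interval Tmin Tmax"
    using open_interval_eq_time_interval[OF I] .
  have eq: "(\<lambda>t. case_sum (\<lambda>n. x t (Inl n)) (\<lambda>n. x t (Inr n))) = x"
    by (auto simp: fun_eq_iff split: sum.split)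
  have sol: "dnlkg_solution p h \<sigma> lam V I f g (\<lambda>t n. x t (Inl n)) (\<lambda>t n. x t (Inr n))"
    unfolding dnlkg_solution_iff eq using x bspec[OF init InlI] bspec[OF init InrI] by simp
  have J: "J \<subseteq> I" if "is_interval J" "0 \<in> J" "dnlkg_solution p h \<sigma> lam V J f g u v" for J u v
    by (rule max[rule_format, of J "\<lambda>t. case_sum (u t) (v t)"])
      (use that in \<open>auto simp: dnlkg_solution_iff\<close>)
  have "dnlkg_maximal_solution p h \<sigma> lam V Tmin Tmax f g (\<lambda>t n. x t (Inl n)) (\<lambda>t n. x t (Inr n))"
    unfolding dnlkg_maximal_solution_def T(3)[symmetric]
    by (intro conjI T(1,2) sol allI impI, elim conjE, rule J, assumption+)
  then show "\<exists>Tmin Tmax u v. dnlkg_maximal_solution p h \<sigma> lam V Tmin Tmax f g u v" by blast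
qed

text \<open>The abstract result produces some nearby solution for the perturbed datum. Maximality
  places its interval inside that of the given solution, and uniqueness identifies the two.\<close>

lemma dnlkg_continuous_dependence: "continuous_dependence p h \<sigma> lam V"
  unfolding continuous_dependence_def
proof (intro allI impI, elim conjE)
  fix f g Tmin Tmax u v fk gk Tmink Tmaxk uk vk a b
  assume fgk: "\<forall>k::nat. (fk k, gk k) \<in> X0_space p h"
    and lim: "(\<lambda>k. X0_dist p h (fk k, gk k) (f, g)) \<longlonglongrightarrow> 0"
    and sol: "dnlkg_maximal_solution p h \<sigma> lam V Tmin Tmax f g u v"
    and solk: "\<forall>k. dnlkg_maximal_solution p h \<sigma> lam V (Tmink k) (Tmaxk k) (fk k) (gk k) (uk k) (vk k)"
    and ab: "{a..b} \<subseteq> time_interval Tmin Tmax"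
    and fg: "(f, g) \<in> X0_space p h"
  define I where "I = time_interval Tmin Tmax"
  \<comment> \<open>The interval \<open>{a..b}\<close> may miss the initial time, so it is enlarged
    to contain 0.\<close>
  define J where "J = {min a 0..max b 0}"
  have sol_I: "dnlkg_solution p h \<sigma> lam V I f g u v" and "0 < Tmin" "0 < Tmax"
    using sol by (auto simp: dnlkg_maximal_solution_def I_def)
  then have "- Tmin < 0" by (metis ereal_uminus_less_reorder ereal_uminus_zero)
  then have zero_I: "0 \<in> I"
    using \<open>0 < Tmax\<close> by (simp add: I_def time_interval_def zero_ereal_def[symmetric])
  have main: "\<forall>\<^sub>F k in sequentially. {a..b} \<subseteq> time_interval (Tmink k) (Tmaxk k) \<and>
      (\<forall>t\<in>{a..b}. X0_dist p h (uk k t, vk k t) (u t, v t) < e)" if e: "e > 0" for e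
  \<comment> \<open>For \<open>a > b\<close> the interval is empty and both claims hold
    vacuously.\<close>
  proof (cases "a \<le> b")
    case True
    then have "min a 0 \<in> I" "max b 0 \<in> I" using ab zero_I by (auto simp: min_def max_def I_def)
    then have "J \<subseteq> I"
      using mem_is_interval_1_I[of I "min a 0" "max b 0"] is_interval_time_interval[of Tmin Tmax]
      unfolding J_def I_def by (metis atLeastAtMost_iff subsetI)
    have J: "is_interval J" "0 \<in> J" "{a..b} \<subseteq> J" by (auto simp: J_def is_interval_convex_1)
    let ?x = "\<lambda>t. case_sum (u t) (v t)"
    have x: "pair.solves phase_field J ?x"
      using sol_I by (intro pair.solves_subset[OF _ \<open>J \<subseteq> I\<close>]) (simp add: dnlkg_solution_iff)
    have "min a 0 \<le> 0" "0 \<le> max b 0" by auto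
    from pair.continuous_dependence_on_initial_value[OF phase_field_locally_lipschitz x[unfolded J_def] this e,
        folded J_def]
    obtain d where d: "d > 0" and
      dep: "\<forall>y0\<in>{w. (\<lambda>n. w (Inl n)) \<in> lp_space p h \<and> (\<lambda>n. w (Inr n)) \<in> lp_space p h}.
        pair.D y0 (?x 0) < d \<longrightarrow> (\<exists>y. pair.solves phase_field J y \<and>
          (\<forall>n\<in>hlattice h <+> hlattice h. y 0 n = y0 n) \<and> (\<forall>t\<in>J. pair.D (y t) (?x t) < e))"
      by blast
    have "\<forall>\<^sub>F k in sequentially. X0_dist p h (fk k, gk k) (f, g) < d"
      using order_tendstoD(2)[OF lim d] .
    then show ?thesis
    proof eventually_elim
      case (elim k)
      have mk: "case_sum (fk k) (gk k) \<in> {w. (\<lambda>n. w (Inl n)) \<in> lp_space p h \<and> (\<lambda>n. w (Inr n)) \<in> lp_space p h}"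
        using fgk by (simp add: X0_space_def)
      \<comment> \<open>The solution takes its initial values only on the lattice, so the functions
        may differ while the distances agree.\<close>
      have "X0_dist p h (fk k, gk k) (u 0, v 0) = X0_dist p h (fk k, gk k) (f, g)"
      proof -
        have "lp_norm p h (\<lambda>n. fk k n - f n) = lp_norm p h (\<lambda>n. fk k n - u 0 n)"
          "lp_norm p h (\<lambda>n. gk k n - g n) = lp_norm p h (\<lambda>n. gk k n - v 0 n)"
          using fgk fg sol_I by (auto simp: X0_space_def dnlkg_solution_iff intro!: lp.N_cong lp.diff)
        then show ?thesis by (simp add: X0_dist_def)
      qed
      then have "pair.D (case_sum (fk k) (gk k)) (?x 0) < d" using elim by (simp add: pair_D_case_sum)
      from dep[rule_format, OF mk this] obtain y where y: "pair.solves phase_field J y"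
        "\<And>n. n \<in> hlattice h <+> hlattice h \<Longrightarrow> y 0 n = case_sum (fk k) (gk k) n"
        "\<And>t. t \<in> J \<Longrightarrow> pair.D (y t) (?x t) < e" by blast
      define yu where "yu t n = y t (Inl n)" for t n
      define yv where "yv t n = y t (Inr n)" for t n
      have eq: "case_sum (yu t) (yv t) = y t" for t
        by (auto simp: yu_def yv_def fun_eq_iff split: sum.split)
      have yJ: "dnlkg_solution p h \<sigma> lam V J (fk k) (gk k) yu yv"
        unfolding dnlkg_solution_iff eq using y(1) y(2)[OF InlI] y(2)[OF InrI] by (simp add: yu_def yv_def)
      have maxk: "dnlkg_maximal_solution p h \<sigma> lam V (Tmink k) (Tmaxk k) (fk k) (gk k) (uk k) (vk k)"
        using solk by blast
      then have sub: "J \<subseteq> time_interval (Tmink k) (Tmaxk k)"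
        using J(1,2) yJ unfolding dnlkg_maximal_solution_def by blast
      have kJ: "dnlkg_solution p h \<sigma> lam V J (fk k) (gk k) (uk k) (vk k)"
        using maxk pair.solves_subset[OF _ sub] by (auto simp: dnlkg_maximal_solution_def dnlkg_solution_iff)
      have "X0_dist p h (uk k t, vk k t) (u t, v t) < e" if t: "t \<in> J" for t
      proof -
        have mem: "case_sum (uk k t) (vk k t) \<in> {w. (\<lambda>n. w (Inl n)) \<in> lp_space p h \<and> (\<lambda>n. w (Inr n)) \<in> lp_space p h}"
          "?x t \<in> {w. (\<lambda>n. w (Inl n)) \<in> lp_space p h \<and> (\<lambda>n. w (Inr n)) \<in> lp_space p h}"
          using kJ x t unfolding dnlkg_solution_iff pair.solves_def
          by (auto dest!: pair.norm_continuous_on_mem)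
        have "pair.D (case_sum (uk k t) (vk k t)) (?x t) = pair.D (case_sum (yu t) (yv t)) (?x t)"
          unfolding pair.D_def
          by (rule pair.N_cong[OF pair.diff[OF mem]])
             (use dnlkg_unique[OF kJ yJ J(1,2) t] in \<open>auto simp: Plus_def\<close>)
        then show ?thesis using y(3)[OF t] by (simp add: pair_D_case_sum eq)
      qed
      then show ?case using sub J(3) by blast
    qed
  qed simp
  show "(\<forall>\<^sub>F k in sequentially. {a..b} \<subseteq> time_interval (Tmink k) (Tmaxk k)) \<and>
      (\<forall>\<epsilon>>0. \<forall>\<^sub>F k in sequentially. \<forall>t\<in>{a..b}. X0_dist p h (uk k t, vk k t) (u t, v t) < \<epsilon>)"
  proof (intro conjI allI impI)
    show "\<forall>\<^sub>F k in sequentially. {a..b} \<subseteq> time_interval (Tmink k) (Tmaxk k)"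
      by (rule eventually_mono[OF main[OF zero_less_one]]) simp
    show "\<forall>\<^sub>F k in sequentially. \<forall>t\<in>{a..b}. X0_dist p h (uk k t, vk k t) (u t, v t) < e" if "e > 0" for e
      by (rule eventually_mono[OF main[OF that]]) simp
  qed
qed

end

theorem theorem1p4:
  fixes h \<sigma> lam :: real and p :: ereal and V :: "real ^ 'd \<Rightarrow> real"
  assumes "0 < h" and "h \<le> 1"
    and "0 < \<sigma>"
    and "1 \<le> p"
    and "lam \<in> {1, -1}"
    and "bounded (V ` hlattice h)"
  shows "dnlkg_locally_well_posed p h \<sigma> lam V"
proof -
  interpret dnlkg h \<sigma> lam p V by unfold_locales (use assms in auto)
  have "unconditional_uniqueness p h \<sigma> lam V"
    unfolding unconditional_uniqueness_def using dnlkg_unique by blast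
  then show ?thesis
    unfolding dnlkg_locally_well_posed_def
    using dnlkg_maximal_existence dnlkg_continuous_dependence by blast
qed

end
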